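(* Let $n=2^\eta$ with $\eta\ge1$ an integer, and let $\mu:G_n\to[0,1]$ be a probability measure on the $n\times n$ unit grid $G_n$ with cyclic boundary conditions. Let $\varepsilon_1,\varepsilon_2$ be independent random signed measures on $G_n$, each distributed according to the zero-sum Gaussian noise model with parameter $\sigma>0$ described in the context. Then $$\frac{n\sigma}{\sqrt{\pi}}\ \le\ \mathbb{E}\,W_1^{\pm}(\mu+\varepsilon_1,\mu+\varepsilon_2)\ \le\ \frac{2\sqrt2\,\log_2 n+1/\sqrt2}{\sqrt\pi}\,n\sigma .$$
   Context: $G_n=\{0,\tfrac1n,\dots,\tfrac{n-1}{n}\}^2$ is the $n\times n$ unit pixel grid with cyclic boundary conditions, with ground distance $\mathsf d$ the Euclidean (flat torus) distance $\mathsf d(x,y)=\big(\sum_{i=1}^2\min(|x_i-y_i|,1-|x_i-y_i|)^2\big)^{1/2}$. Functions on $G_n$ are identified with signed measures on $G_n$ (the value at a pixel is its point mass); $a_+=\max(a,0)$, $a_-=\max(-a,0)$ pixelwise. Zero-sum Gaussian noise model: with $m=n^2$, the vector of noise values $(\varepsilon(x))_{x\in G_n}$ is distributed as $\mathcal N(0,\Sigma)$, where $\Sigma$ is the $m\times m$ matrix with diagonal entries $\sigma^2$ and off-diagonal entries $-\sigma^2/(m-1)$. In particular $\sum_x\varepsilon(x)=0$ almost surely. For $p\in\mathbb N$, $p\ge1$, and nonnegative measures $\alpha,\beta$ on $G_n$ of equal total mass, $W_p(\alpha,\beta)=\big(\inf_{\pi\in\Gamma(\alpha,\beta)}\sum_{x,y}\mathsf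 d(x,y)^p\pi(x,y)\big)^{1/p}$, where $\Gamma(\alpha,\beta)$ is the set of nonnegative measures on $G_n\times G_n$ with marginals $\alpha,\beta$. For signed measures $\rho,\tau$ on $G_n$ of equal total mass, the signed Wasserstein discrepancy is $W_p^{\pm}(\rho,\tau)=W_p(\rho_++\tau_-,\ \tau_++\rho_-)$. *)

theory Defs
  imports "HOL-Probability.Probability"
begin

type_synonym pixel = "real \<times> real"

definition grid :: "nat \<Rightarrow> pixel set" where
  "grid n = {(real i / real n, real j / real n) | i j. i < n \<and> j < n}"

definition torus_dist :: "pixel \<Rightarrow> pixel \<Rightarrow> real" where
  "torus_dist x y =
     sqrt ((min \<bar>fst x - fst y\<bar> (1 - \<bar>fst x - fst y\<bar>))\<^sup>2
         + (min \<bar>snd x - snd y\<bar> (1 - \<bar>snd x - snd y\<bar>))\<^sup>2)"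

text \<open>
  A signed measure on \<open>grid n\<close> is given by its point masses, i.e. by a function
  \<open>pixel \<Rightarrow> real\<close> of which only the values on \<open>grid n\<close> matter.
\<close>

definition prob_on_grid :: "nat \<Rightarrow> (pixel \<Rightarrow> real) \<Rightarrow> bool" where
  "prob_on_grid n \<mu> \<longleftrightarrow> (\<forall>x\<in>grid n. 0 \<le> \<mu> x \<and> \<mu> x \<le> 1) \<and> (\<Sum>x\<in>grid n. \<mu> x) = 1"

definition couplings ::
  "nat \<Rightarrow> (pixel \<Rightarrow> real) \<Rightarrow> (pixel \<Rightarrow> real) \<Rightarrow> (pixel \<Rightarrow> pixel \<Rightarrow> real) set" where
  "couplings n \<alpha> \<beta> =
     {\<pi>. (\<forall>x\<in>grid n. \<forall>y\<in>grid n. 0 \<le> \<pi> x y)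
        \<and> (\<forall>x\<in>grid n. (\<Sum>y\<in>grid n. \<pi> x y) = \<alpha> x)
        \<and> (\<forall>y\<in>grid n. (\<Sum>x\<in>grid n. \<pi> x y) = \<beta> y)}"

text \<open>
  Intended for \<open>p \<ge> 1\<close> and nonnegative \<open>\<alpha>\<close>, \<open>\<beta>\<close> of equal total mass. If the masses differ or
  one of them is negative somewhere, then there are no couplings and the infimum is taken over
  the empty set, so it carries no information.
\<close>

definition wasserstein :: "nat \<Rightarrow> nat \<Rightarrow> (pixel \<Rightarrow> real) \<Rightarrow> (pixel \<Rightarrow> real) \<Rightarrow> real" where
  "wasserstein n p \<alpha> \<beta> =
     root p (INF \<pi>\<in>couplings n \<alpha> \<beta>. \<Sum>x\<in>grid n. \<Sum>y\<in>grid n. torus_dist x y ^ p * \<pi> x y)"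

definition signed_wasserstein ::
  "nat \<Rightarrow> nat \<Rightarrow> (pixel \<Rightarrow> real) \<Rightarrow> (pixel \<Rightarrow> real) \<Rightarrow> real" where
  "signed_wasserstein n p \<rho> \<tau> =
     wasserstein n p (\<lambda>x. max (\<rho> x) 0 + max (- \<tau> x) 0) (\<lambda>x. max (\<tau> x) 0 + max (- \<rho> x) 0)"

text \<open>The normal law with given mean and variance, a point mass if the variance is zero.\<close>

definition normal_law :: "real \<Rightarrow> real \<Rightarrow> real measure" where
  "normal_law m v =
     (if v = 0 then return borel m else density lborel (\<lambda>x. ennreal (normal_density m (sqrt v) x)))"

text \<open>
  \<open>N\<close> is the centred multivariate normal law on \<open>\<real>\<^sup>I\<close> with covariance matrix \<open>S\<close>: every linear
  functional has the normal law with the variance prescribed by \<open>S\<close>. The covariance matrix may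
  be singular, so the definition cannot go through a Lebesgue density.
\<close>

definition centred_mvnormal ::
  "'i set \<Rightarrow> ('i \<Rightarrow> 'i \<Rightarrow> real) \<Rightarrow> ('i \<Rightarrow> real) measure \<Rightarrow> bool" where
  "centred_mvnormal I S N \<longleftrightarrow>
     sets N = sets (PiM I (\<lambda>_. borel)) \<and>
     (\<forall>t. distr N borel (\<lambda>z. \<Sum>i\<in>I. t i * z i)
        = normal_law 0 (\<Sum>i\<in>I. \<Sum>j\<in>I. t i * S i j * t j))"

definition noise_cov :: "nat \<Rightarrow> real \<Rightarrow> pixel \<Rightarrow> pixel \<Rightarrow> real" where
  "noise_cov n \<sigma> x y = (if x = y then \<sigma>\<^sup>2 else - \<sigma>\<^sup>2 / (real (n\<^sup>2) - 1))"

abbreviation grid_vectors :: "nat \<Rightarrow> (pixel \<Rightarrow> real) measure" where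
  "grid_vectors n \<equiv> PiM (grid n) (\<lambda>_. borel)"

definition zero_sum_gaussian_noise ::
  "'a measure \<Rightarrow> nat \<Rightarrow> real \<Rightarrow> ('a \<Rightarrow> pixel \<Rightarrow> real) \<Rightarrow> bool" where
  "zero_sum_gaussian_noise M n \<sigma> \<epsilon> \<longleftrightarrow>
     \<epsilon> \<in> measurable M (grid_vectors n) \<and>
     centred_mvnormal (grid n) (noise_cov n \<sigma>) (distr M (grid_vectors n) \<epsilon>)"

end

theory Submission
  imports Defs
begin

text \<open>
  Write \<open>\<alpha>\<close> and \<open>\<beta>\<close> for the two nonnegative measures that the signed discrepancy compares. Their
  difference is \<open>D = \<epsilon>1 - \<epsilon>2\<close>, whatever \<open>\<mu>\<close> is, and both bounds are pathwise bounds in terms of \<open>D\<close>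
  (lemma \<open>grid_transport_cost_bounds\<close>), followed by a Gaussian computation.

  Lower bound. At most the mass \<open>min (\<alpha> x) (\<beta> x)\<close> can stay at \<open>x\<close>, so half of the total variation of
  \<open>D\<close> has to move, and each unit that moves travels at least the pixel spacing \<open>1 / n\<close>. Each \<open>D x\<close> is
  normal with variance \<open>2 * \<sigma>^2\<close>, hence \<open>E \<bar>D x\<bar> = 2 * \<sigma> / sqrt pi\<close>, and summing over \<open>n^2\<close> pixels
  gives the claim.

  Upper bound. Match mass greedily, first inside single pixels, then inside the dyadic squares of side
  2, 4, ..., \<open>n\<close> (lemma \<open>multiscale_partial_coupling\<close>). When the squares of side \<open>2^k\<close> have been
  exhausted, a square \<open>B\<close> has unmatched mass \<open>\<bar>D(B)\<bar>\<close>, all of one sign. The next step matches, inside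
  the squares of twice the side, at most half of the total unmatched mass of both signs, at distance
  at most \<open>sqrt 2 * 2^(k + 1) / n\<close>. This costs at most \<open>sqrt 2 * 2^k / n\<close> times the sum of
  \<open>\<bar>D(B)\<bar>\<close>. Since the noise is negatively correlated, \<open>E \<bar>D(B)\<bar>\<close> is at most
  \<open>2 * \<sigma> / sqrt pi * sqrt (card B)\<close>. There are \<open>(n / 2^k)^2\<close> squares with \<open>4^k\<close> pixels each, so each of
  the \<open>log 2 n\<close> levels contributes at most \<open>2 * sqrt 2 * n * \<sigma> / sqrt pi\<close>.

  Integrability also needs the discrepancy to be a measurable function of the noise, although it is an
  infimum over an uncountable set of couplings that depends on the noise. An exact penalty for
  wrong marginals turns it into an infimum over the countable set of all nonnegative rational
  matrices (lemma \<open>transport_cost_eq_penalized\<close>).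
\<close>

section \<open>Greedy matching along nested partitions\<close>

text \<open>
  The couplings of \<open>\<alpha>\<close> and \<open>\<beta>\<close> on an arbitrary carrier; \<open>couplings n\<close> is the case \<open>X = grid n\<close>.
\<close>

definition coupling_on ::
  "'p set \<Rightarrow> ('p \<Rightarrow> real) \<Rightarrow> ('p \<Rightarrow> real) \<Rightarrow> ('p \<Rightarrow> 'p \<Rightarrow> real) \<Rightarrow> bool" where
  "coupling_on X \<alpha> \<beta> \<pi> \<longleftrightarrow>
     (\<forall>x\<in>X. \<forall>y\<in>X. 0 \<le> \<pi> x y)
   \<and> (\<forall>x\<in>X. (\<Sum>y\<in>X. \<pi> x y) = \<alpha> x) \<and> (\<forall>y\<in>X. (\<Sum>x\<in>X. \<pi> x y) = \<beta> y)"

lemma coupling_on_mass: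
  assumes "coupling_on X \<alpha> \<beta> \<pi>"
  shows "(\<Sum>x\<in>X. \<alpha> x) = (\<Sum>x\<in>X. \<Sum>y\<in>X. \<pi> x y)" "(\<Sum>y\<in>X. \<beta> y) = (\<Sum>x\<in>X. \<Sum>y\<in>X. \<pi> x y)"
proof -
  show "(\<Sum>x\<in>X. \<alpha> x) = (\<Sum>x\<in>X. \<Sum>y\<in>X. \<pi> x y)"
    using assms by (intro sum.cong) (auto simp: coupling_on_def)
  have "(\<Sum>y\<in>X. \<beta> y) = (\<Sum>y\<in>X. \<Sum>x\<in>X. \<pi> x y)"
    using assms by (intro sum.cong) (auto simp: coupling_on_def)
  then show "(\<Sum>y\<in>X. \<beta> y) = (\<Sum>x\<in>X. \<Sum>y\<in>X. \<pi> x y)"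
    by (subst sum.swap)
qed

lemma partial_coupling_without_residual:
  assumes X: "finite X" and nonneg: "\<And>x y. x \<in> X \<Longrightarrow> y \<in> X \<Longrightarrow> 0 \<le> \<pi> x y"
    and row: "\<And>x. x \<in> X \<Longrightarrow> (\<Sum>y\<in>X. \<pi> x y) \<le> \<alpha> x"
    and col: "\<And>y. y \<in> X \<Longrightarrow> (\<Sum>x\<in>X. \<pi> x y) \<le> \<beta> y"
    and a0: "(\<Sum>x\<in>X. \<alpha> x - (\<Sum>y\<in>X. \<pi> x y)) = 0"
    and b0: "(\<Sum>y\<in>X. \<beta> y - (\<Sum>x\<in>X. \<pi> x y)) = 0"
  shows "coupling_on X \<alpha> \<beta> \<pi>"
proof -
  have "\<forall>x\<in>X. \<alpha> x - (\<Sum>y\<in>X. \<pi> x y) = 0"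
    using X row a0 by (subst (asm) sum_nonneg_eq_0_iff) auto
  moreover have "\<forall>y\<in>X. \<beta> y - (\<Sum>x\<in>X. \<pi> x y) = 0"
    using X col b0 by (subst (asm) sum_nonneg_eq_0_iff) auto
  ultimately show ?thesis
    using nonneg by (simp add: coupling_on_def)
qed

text \<open>
  One greedy matching step: mass is matched only inside the classes of \<open>q\<close>, and in each class as
  much as possible, so that afterwards each class has a residual on one side only. The factor
  \<open>1/2\<close> in the cost is what makes the leading constant of the final upper bound \<open>2 * sqrt 2\<close>.
\<close>

lemma classwise_matching:
  fixes a b :: "'p \<Rightarrow> real" and c :: "'p \<Rightarrow> 'p \<Rightarrow> real" and q :: "'p \<Rightarrow> 'i"
  assumes X: "finite X"
    and a: "\<And>x. x \<in> X \<Longrightarrow> 0 \<le> a x" and b: "\<And>x. x \<in> X \<Longrightarrow> 0 \<le> b x"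
    and \<delta>: "0 \<le> \<delta>" and c: "\<And>x y. x \<in> X \<Longrightarrow> y \<in> X \<Longrightarrow> q x = q y \<Longrightarrow> c x y \<le> \<delta>"
  obtains \<rho> where
    "\<And>x y. x \<in> X \<Longrightarrow> y \<in> X \<Longrightarrow> 0 \<le> \<rho> x y"
    "\<And>x. x \<in> X \<Longrightarrow> (\<Sum>y\<in>X. \<rho> x y) \<le> a x"
    "\<And>y. y \<in> X \<Longrightarrow> (\<Sum>x\<in>X. \<rho> x y) \<le> b y"
    "\<And>i. (\<Sum>x | x \<in> X \<and> q x = i. a x - (\<Sum>y\<in>X. \<rho> x y))
          = max (\<Sum>x | x \<in> X \<and> q x = i. a x - b x) 0"
    "\<And>i. (\<Sum>y | y \<in> X \<and> q y = i. b y - (\<Sum>x\<in>X. \<rho> x y))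
          = max (- (\<Sum>x | x \<in> X \<and> q x = i. a x - b x)) 0"
    "(\<Sum>x\<in>X. \<Sum>y\<in>X. c x y * \<rho> x y) \<le> \<delta> / 2 * (\<Sum>x\<in>X. a x + b x)"
proof -
  define A where "A i = (\<Sum>x | x \<in> X \<and> q x = i. a x)" for i
  define B where "B i = (\<Sum>x | x \<in> X \<and> q x = i. b x)" for i
  (* The product coupling in each class, scaled so that the lighter side is used up; in a class
     where both masses vanish, the quotient 0 / 0 = 0 is the intended value. *)
  define \<rho> where "\<rho> x y = (if q x = q y then a x * b y / max (A (q x)) (B (q x)) else 0)" for x y
  have A0: "0 \<le> A i" and B0: "0 \<le> B i" for i
    unfolding A_def B_def using a b by (auto intro!: sum_nonneg)
  have row: "(\<Sum>y\<in>X. \<rho> x y) = a x * (B (q x) / max (A (q x)) (B (q x)))" for x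
  proof -
    have "(\<Sum>y\<in>X. \<rho> x y) = (\<Sum>y\<in>X. if q y = q x then a x * b y / max (A (q x)) (B (q x)) else 0)"
      unfolding \<rho>_def by (intro sum.cong) auto
    also have "\<dots> = (\<Sum>y | y \<in> X \<and> q y = q x. a x * b y / max (A (q x)) (B (q x)))"
      using X by (simp add: sum.inter_filter)
    finally show ?thesis by (simp add: B_def sum_distrib_left sum_divide_distrib)
  qed
  have col: "(\<Sum>x\<in>X. \<rho> x y) = b y * (A (q y) / max (A (q y)) (B (q y)))" for y
  proof -
    have "(\<Sum>x\<in>X. \<rho> x y) = (\<Sum>x\<in>X. if q x = q y then a x * b y / max (A (q y)) (B (q y)) else 0)"
      unfolding \<rho>_def by (intro sum.cong) auto
    also have "\<dots> = (\<Sum>x | x \<in> X \<and> q x = q y. a x * b y / max (A (q y)) (B (q y)))"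
      using X by (simp add: sum.inter_filter)
    finally show ?thesis by (simp add: A_def sum_distrib_left sum_divide_distrib mult.commute)
  qed
  have nonneg: "0 \<le> \<rho> x y" if "x \<in> X" "y \<in> X" for x y
    unfolding \<rho>_def using a[OF that(1)] b[OF that(2)] A0[of "q x"]
    by (auto intro!: divide_nonneg_nonneg simp: le_max_iff_disj)
  have frac: "B i / max (A i) (B i) \<le> 1" "A i / max (A i) (B i) \<le> 1" for i
    using A0[of i] B0[of i] by (auto simp: divide_le_eq max_def)
  have row_le: "(\<Sum>y\<in>X. \<rho> x y) \<le> a x" if "x \<in> X" for x
    unfolding row using mult_left_mono[OF frac(1)[of "q x"] a[OF that]] by simp
  have col_le: "(\<Sum>x\<in>X. \<rho> x y) \<le> b y" if "y \<in> X" for y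
    unfolding col using mult_left_mono[OF frac(2)[of "q y"] b[OF that]] by simp
  have diff: "(\<Sum>x | x \<in> X \<and> q x = i. a x - b x) = A i - B i" for i
    by (simp add: A_def B_def sum_subtractf)
  have resa: "(\<Sum>x | x \<in> X \<and> q x = i. a x - (\<Sum>y\<in>X. \<rho> x y)) = max (A i - B i) 0" for i
  proof -
    have "(\<Sum>x | x \<in> X \<and> q x = i. a x - (\<Sum>y\<in>X. \<rho> x y))
        = (\<Sum>x | x \<in> X \<and> q x = i. a x * (1 - B i / max (A i) (B i)))"
      unfolding row by (intro sum.cong) (auto simp: algebra_simps)
    also have "\<dots> = A i * (1 - B i / max (A i) (B i))"
      by (simp add: A_def sum_distrib_right)
    also have "\<dots> = max (A i - B i) 0"
      using A0[of i] B0[of i] by (cases "A i = 0") (auto simp: max_def field_simps)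
    finally show ?thesis .
  qed
  have resb: "(\<Sum>y | y \<in> X \<and> q y = i. b y - (\<Sum>x\<in>X. \<rho> x y)) = max (- (A i - B i)) 0" for i
  proof -
    have "(\<Sum>y | y \<in> X \<and> q y = i. b y - (\<Sum>x\<in>X. \<rho> x y))
        = (\<Sum>y | y \<in> X \<and> q y = i. b y * (1 - A i / max (A i) (B i)))"
      unfolding col by (intro sum.cong) (auto simp: algebra_simps)
    also have "\<dots> = B i * (1 - A i / max (A i) (B i))"
      by (simp add: B_def sum_distrib_right)
    also have "\<dots> = max (- (A i - B i)) 0"
      using A0[of i] B0[of i] by (cases "B i = 0") (auto simp: max_def field_simps)
    finally show ?thesis .
  qed
  have "(\<Sum>x\<in>X. \<Sum>y\<in>X. c x y * \<rho> x y) \<le> (\<Sum>x\<in>X. \<Sum>y\<in>X. \<delta> * \<rho> x y)"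
  proof (intro sum_mono)
    fix x y assume xy: "x \<in> X" "y \<in> X"
    show "c x y * \<rho> x y \<le> \<delta> * \<rho> x y"
    proof (cases "q x = q y")
      case True
      then show ?thesis by (intro mult_right_mono c nonneg xy)
    qed (simp add: \<rho>_def)
  qed
  also have "\<dots> = \<delta> * (\<Sum>x\<in>X. \<Sum>y\<in>X. \<rho> x y)"
    by (simp add: sum_distrib_left)
  (* The matched mass is at most each of the two total masses, hence at most their mean. *)
  also have "\<dots> \<le> \<delta> * ((\<Sum>x\<in>X. a x + b x) / 2)"
  proof (rule mult_left_mono[OF _ \<delta>])
    have "(\<Sum>x\<in>X. \<Sum>y\<in>X. \<rho> x y) \<le> (\<Sum>x\<in>X. a x)" by (intro sum_mono row_le)
    moreover have "(\<Sum>x\<in>X. \<Sum>y\<in>X. \<rho> x y) \<le> (\<Sum>x\<in>X. b x)"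
      by (subst sum.swap) (intro sum_mono col_le)
    ultimately show "(\<Sum>x\<in>X. \<Sum>y\<in>X. \<rho> x y) \<le> (\<Sum>x\<in>X. a x + b x) / 2"
      by (simp add: sum.distrib)
  qed
  finally have cost: "(\<Sum>x\<in>X. \<Sum>y\<in>X. c x y * \<rho> x y) \<le> \<delta> / 2 * (\<Sum>x\<in>X. a x + b x)"
    by simp
  show thesis
    using that[of \<rho>] nonneg row_le col_le resa resb cost unfolding diff by blast
qed

text \<open>
  The greedy matching run from the finest partition \<open>q 0\<close> up to \<open>q k\<close>. The two residual identities
  are the invariant that carries the induction: before step \<open>j\<close> the unmatched mass in a class of
  \<open>q j\<close> is exactly the absolute imbalance of the class, and it is matched at distance at most
  \<open>\<delta> (Suc j)\<close>.
\<close>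

lemma multiscale_partial_coupling:
  fixes \<alpha> \<beta> :: "'p \<Rightarrow> real" and c :: "'p \<Rightarrow> 'p \<Rightarrow> real" and q :: "nat \<Rightarrow> 'p \<Rightarrow> 'i"
  assumes X: "finite X"
    and \<alpha>: "\<And>x. x \<in> X \<Longrightarrow> 0 \<le> \<alpha> x" and \<beta>: "\<And>x. x \<in> X \<Longrightarrow> 0 \<le> \<beta> x"
    and diag: "\<And>x. x \<in> X \<Longrightarrow> c x x = 0"
    and inj: "inj_on (q 0) X"
    and coarser: "\<And>k x y. x \<in> X \<Longrightarrow> y \<in> X \<Longrightarrow> q k x = q k y \<Longrightarrow> q (Suc k) x = q (Suc k) y"
    and \<delta>: "\<And>k. 0 \<le> \<delta> k"
    and c: "\<And>k x y. x \<in> X \<Longrightarrow> y \<in> X \<Longrightarrow> q k x = q k y \<Longrightarrow> c x y \<le> \<delta> k"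
  shows "\<exists>\<pi>. (\<forall>x\<in>X. \<forall>y\<in>X. 0 \<le> \<pi> x y)
      \<and> (\<forall>x\<in>X. (\<Sum>y\<in>X. \<pi> x y) \<le> \<alpha> x) \<and> (\<forall>y\<in>X. (\<Sum>x\<in>X. \<pi> x y) \<le> \<beta> y)
      \<and> (\<forall>i. (\<Sum>x | x \<in> X \<and> q k x = i. \<alpha> x - (\<Sum>y\<in>X. \<pi> x y))
            = max (\<Sum>x | x \<in> X \<and> q k x = i. \<alpha> x - \<beta> x) 0)
      \<and> (\<forall>i. (\<Sum>y | y \<in> X \<and> q k y = i. \<beta> y - (\<Sum>x\<in>X. \<pi> x y))
            = max (- (\<Sum>x | x \<in> X \<and> q k x = i. \<alpha> x - \<beta> x)) 0)
      \<and> (\<Sum>x\<in>X. \<Sum>y\<in>X. c x y * \<pi> x y)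
          \<le> (\<Sum>j<k. \<delta> (Suc j) / 2 * (\<Sum>i\<in>q j ` X. \<bar>\<Sum>x | x \<in> X \<and> q j x = i. \<alpha> x - \<beta> x\<bar>))"
proof (induction k)
  case 0
  (* At the finest level the classes are singletons: leave the common mass in place, for free. *)
  define \<pi> where "\<pi> x y = (if x = y then min (\<alpha> x) (\<beta> x) else 0)" for x y
  have row: "(\<Sum>y\<in>X. \<pi> x y) = min (\<alpha> x) (\<beta> x)" if "x \<in> X" for x
    using X that by (simp add: \<pi>_def)
  have col: "(\<Sum>x\<in>X. \<pi> x y) = min (\<alpha> y) (\<beta> y)" if "y \<in> X" for y
    using X that by (simp add: \<pi>_def)
  have single: "{x. x \<in> X \<and> q 0 x = i} = {} \<or> (\<exists>z\<in>X. {x. x \<in> X \<and> q 0 x = i} = {z})" for i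
    using inj unfolding inj_on_def by blast
  have 1: "(\<Sum>x | x \<in> X \<and> q 0 x = i. \<alpha> x - (\<Sum>y\<in>X. \<pi> x y))
            = max (\<Sum>x | x \<in> X \<and> q 0 x = i. \<alpha> x - \<beta> x) 0" for i
    using single[of i]
  proof
    assume "{x. x \<in> X \<and> q 0 x = i} = {}"
    then show ?thesis by (simp only: sum.empty minus_zero max.idem)
  next
    assume "\<exists>z\<in>X. {x. x \<in> X \<and> q 0 x = i} = {z}"
    then obtain z where "z \<in> X" "{x. x \<in> X \<and> q 0 x = i} = {z}" by blast
    then show ?thesis using row[of z] by (simp add: max_def min_def)
  qed
  have 2: "(\<Sum>y | y \<in> X \<and> q 0 y = i. \<beta> y - (\<Sum>x\<in>X. \<pi> x y))
            = max (- (\<Sum>x | x \<in> X \<and> q 0 x = i. \<alpha> x - \<beta> x)) 0" for i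
    using single[of i]
  proof
    assume "{x. x \<in> X \<and> q 0 x = i} = {}"
    then show ?thesis by (simp only: sum.empty minus_zero max.idem)
  next
    assume "\<exists>z\<in>X. {x. x \<in> X \<and> q 0 x = i} = {z}"
    then obtain z where "z \<in> X" "{x. x \<in> X \<and> q 0 x = i} = {z}" by blast
    then show ?thesis using col[of z] by (simp add: max_def min_def)
  qed
  have "(\<Sum>x\<in>X. \<Sum>y\<in>X. c x y * \<pi> x y) = 0"
    by (intro sum.neutral ballI) (auto simp: \<pi>_def diag)
  then show ?case
    using 1 2 row col \<alpha> \<beta> by (intro exI[of _ \<pi>]) (auto simp: \<pi>_def)
next
  case (Suc k)
  define f where "f x = \<alpha> x - \<beta> x" for x
  from Suc.IH obtain \<pi> where nonneg: "\<forall>x\<in>X. \<forall>y\<in>X. 0 \<le> \<pi> x y"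
    and row: "\<forall>x\<in>X. (\<Sum>y\<in>X. \<pi> x y) \<le> \<alpha> x" and col: "\<forall>y\<in>X. (\<Sum>x\<in>X. \<pi> x y) \<le> \<beta> y"
    and resa: "\<And>i. (\<Sum>x | x \<in> X \<and> q k x = i. \<alpha> x - (\<Sum>y\<in>X. \<pi> x y))
            = max (\<Sum>x | x \<in> X \<and> q k x = i. f x) 0"
    and resb: "\<And>i. (\<Sum>y | y \<in> X \<and> q k y = i. \<beta> y - (\<Sum>x\<in>X. \<pi> x y))
            = max (- (\<Sum>x | x \<in> X \<and> q k x = i. f x)) 0"
    and cost: "(\<Sum>x\<in>X. \<Sum>y\<in>X. c x y * \<pi> x y)
          \<le> (\<Sum>j<k. \<delta> (Suc j) / 2 * (\<Sum>i\<in>q j ` X. \<bar>\<Sum>x | x \<in> X \<and> q j x = i. f x\<bar>))"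
    unfolding f_def by blast
  define a where "a x = \<alpha> x - (\<Sum>y\<in>X. \<pi> x y)" for x
  define b where "b y = \<beta> y - (\<Sum>x\<in>X. \<pi> x y)" for y
  have ab: "(\<Sum>x | x \<in> X \<and> q k x = i. a x - b x) = (\<Sum>x | x \<in> X \<and> q k x = i. f x)" for i
    using resa[of i] resb[of i] by (simp add: a_def b_def sum_subtractf max_def split: if_splits)
  (* Each class of level k + 1 is a union of classes of level k, and within each of those the
     residuals still differ by the imbalance of \<alpha> and \<beta>. *)
  have ab': "(\<Sum>x | x \<in> X \<and> q (Suc k) x = i. a x - b x)
      = (\<Sum>x | x \<in> X \<and> q (Suc k) x = i. f x)" (is "sum _ ?C = _") for i
  proof -
    have cls: "{x \<in> ?C. q k x = j} = {x. x \<in> X \<and> q k x = j}" if "j \<in> q k ` ?C" for j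
      using that coarser by blast
    have "(\<Sum>x\<in>?C. g x) = (\<Sum>j\<in>q k ` ?C. \<Sum>x | x \<in> X \<and> q k x = j. g x)" for g :: "'p \<Rightarrow> real"
      using X sum.image_gen[of ?C g "q k"] cls by simp
    then show ?thesis using ab by simp
  qed
  obtain \<rho> where r: "\<And>x y. x \<in> X \<Longrightarrow> y \<in> X \<Longrightarrow> 0 \<le> \<rho> x y"
    "\<And>x. x \<in> X \<Longrightarrow> (\<Sum>y\<in>X. \<rho> x y) \<le> a x"
    "\<And>y. y \<in> X \<Longrightarrow> (\<Sum>x\<in>X. \<rho> x y) \<le> b y"
    "\<And>i. (\<Sum>x | x \<in> X \<and> q (Suc k) x = i. a x - (\<Sum>y\<in>X. \<rho> x y))
          = max (\<Sum>x | x \<in> X \<and> q (Suc k) x = i. f x) 0"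
    "\<And>i. (\<Sum>y | y \<in> X \<and> q (Suc k) y = i. b y - (\<Sum>x\<in>X. \<rho> x y))
          = max (- (\<Sum>x | x \<in> X \<and> q (Suc k) x = i. f x)) 0"
    "(\<Sum>x\<in>X. \<Sum>y\<in>X. c x y * \<rho> x y) \<le> \<delta> (Suc k) / 2 * (\<Sum>x\<in>X. a x + b x)"
  proof (rule classwise_matching[of X a b "\<delta> (Suc k)" "q (Suc k)" c, unfolded ab', OF X])
    show "0 \<le> a x" if "x \<in> X" for x using row that by (simp add: a_def)
    show "0 \<le> b y" if "y \<in> X" for y using col that by (simp add: b_def)
  qed (use \<delta> c in blast)+
  (* In each class of level k only one side has a residual, so the unmatched mass is the
     absolute imbalance. *)
  have "(\<Sum>x\<in>X. a x + b x) = (\<Sum>i\<in>q k ` X. \<Sum>x | x \<in> X \<and> q k x = i. a x + b x)"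
    using X sum.image_gen[of X "\<lambda>x. a x + b x" "q k"] by simp
  also have "\<dots> = (\<Sum>i\<in>q k ` X. \<bar>\<Sum>x | x \<in> X \<and> q k x = i. f x\<bar>)"
    using resa resb by (intro sum.cong) (auto simp: sum.distrib a_def b_def max_def)
  finally have mass: "(\<Sum>x\<in>X. a x + b x) = (\<Sum>i\<in>q k ` X. \<bar>\<Sum>x | x \<in> X \<and> q k x = i. f x\<bar>)" .
  show ?case
  proof (intro exI[of _ "\<lambda>x y. \<pi> x y + \<rho> x y"] conjI ballI allI)
    show "0 \<le> \<pi> x y + \<rho> x y" if "x \<in> X" "y \<in> X" for x y
      using nonneg r(1) that by (simp add: add_nonneg_nonneg)
    show "(\<Sum>y\<in>X. \<pi> x y + \<rho> x y) \<le> \<alpha> x" if "x \<in> X" for x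
      using r(2)[OF that] by (simp add: sum.distrib a_def)
    show "(\<Sum>x\<in>X. \<pi> x y + \<rho> x y) \<le> \<beta> y" if "y \<in> X" for y
      using r(3)[OF that] by (simp add: sum.distrib b_def)
    show "(\<Sum>x | x \<in> X \<and> q (Suc k) x = i. \<alpha> x - (\<Sum>y\<in>X. \<pi> x y + \<rho> x y))
          = max (\<Sum>x | x \<in> X \<and> q (Suc k) x = i. \<alpha> x - \<beta> x) 0" for i
      using r(4)[of i] by (simp add: sum.distrib a_def f_def algebra_simps)
    show "(\<Sum>y | y \<in> X \<and> q (Suc k) y = i. \<beta> y - (\<Sum>x\<in>X. \<pi> x y + \<rho> x y))
          = max (- (\<Sum>x | x \<in> X \<and> q (Suc k) x = i. \<alpha> x - \<beta> x)) 0" for i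
      using r(5)[of i] by (simp add: sum.distrib b_def f_def algebra_simps)
    show "(\<Sum>x\<in>X. \<Sum>y\<in>X. c x y * (\<pi> x y + \<rho> x y)) \<le> (\<Sum>j<Suc k. \<delta> (Suc j) / 2 *
        (\<Sum>i\<in>q j ` X. \<bar>\<Sum>x | x \<in> X \<and> q j x = i. \<alpha> x - \<beta> x\<bar>))"
      using cost r(6) unfolding mass by (simp add: sum.distrib distrib_left f_def)
  qed
qed

text \<open>
  Once the partition is trivial, the imbalance is zero and the greedy matching is a coupling.
\<close>

lemma multiscale_coupling:
  fixes \<alpha> \<beta> :: "'p \<Rightarrow> real" and c :: "'p \<Rightarrow> 'p \<Rightarrow> real" and q :: "nat \<Rightarrow> 'p \<Rightarrow> 'i"
  assumes X: "finite X"
    and \<alpha>: "\<And>x. x \<in> X \<Longrightarrow> 0 \<le> \<alpha> x" and \<beta>: "\<And>x. x \<in> X \<Longrightarrow> 0 \<le> \<beta> x"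
    and mass: "(\<Sum>x\<in>X. \<alpha> x - \<beta> x) = 0"
    and diag: "\<And>x. x \<in> X \<Longrightarrow> c x x = 0"
    and inj: "inj_on (q 0) X"
    and coarser: "\<And>k x y. x \<in> X \<Longrightarrow> y \<in> X \<Longrightarrow> q k x = q k y \<Longrightarrow> q (Suc k) x = q (Suc k) y"
    and const: "\<And>x. x \<in> X \<Longrightarrow> q k x = i0"
    and \<delta>: "\<And>k. 0 \<le> \<delta> k"
    and c: "\<And>k x y. x \<in> X \<Longrightarrow> y \<in> X \<Longrightarrow> q k x = q k y \<Longrightarrow> c x y \<le> \<delta> k"
  obtains \<pi> where "coupling_on X \<alpha> \<beta> \<pi>"
    "(\<Sum>x\<in>X. \<Sum>y\<in>X. c x y * \<pi> x y)
      \<le> (\<Sum>j<k. \<delta> (Suc j) / 2 * (\<Sum>i\<in>q j ` X. \<bar>\<Sum>x | x \<in> X \<and> q j x = i. \<alpha> x - \<beta> x\<bar>))"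
proof -
  have all: "{x. x \<in> X \<and> q k x = i0} = X" using const by auto
  obtain \<pi> where nonneg: "\<forall>x\<in>X. \<forall>y\<in>X. 0 \<le> \<pi> x y"
    and row: "\<forall>x\<in>X. (\<Sum>y\<in>X. \<pi> x y) \<le> \<alpha> x" and col: "\<forall>y\<in>X. (\<Sum>x\<in>X. \<pi> x y) \<le> \<beta> y"
    and resa: "\<forall>i. (\<Sum>x | x \<in> X \<and> q k x = i. \<alpha> x - (\<Sum>y\<in>X. \<pi> x y))
            = max (\<Sum>x | x \<in> X \<and> q k x = i. \<alpha> x - \<beta> x) 0"
    and resb: "\<forall>i. (\<Sum>y | y \<in> X \<and> q k y = i. \<beta> y - (\<Sum>x\<in>X. \<pi> x y))
            = max (- (\<Sum>x | x \<in> X \<and> q k x = i. \<alpha> x - \<beta> x)) 0"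
    and cost: "(\<Sum>x\<in>X. \<Sum>y\<in>X. c x y * \<pi> x y)
      \<le> (\<Sum>j<k. \<delta> (Suc j) / 2 * (\<Sum>i\<in>q j ` X. \<bar>\<Sum>x | x \<in> X \<and> q j x = i. \<alpha> x - \<beta> x\<bar>))"
    using multiscale_partial_coupling[of X \<alpha> \<beta> c q \<delta> k, OF X \<alpha> \<beta> diag inj coarser \<delta> c]
    by blast
  have "coupling_on X \<alpha> \<beta> \<pi>"
  proof (rule partial_coupling_without_residual[OF X])
    show "(\<Sum>x\<in>X. \<alpha> x - (\<Sum>y\<in>X. \<pi> x y)) = 0"
      using resa[rule_format, of i0] mass unfolding all by simp
    show "(\<Sum>y\<in>X. \<beta> y - (\<Sum>x\<in>X. \<pi> x y)) = 0"
      using resb[rule_format, of i0] mass unfolding all by simp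
  qed (use nonneg row col in auto)
  then show thesis using cost by (rule that)
qed

section \<open>A lower bound by total variation\<close>

lemma transport_cost_ge_total_variation:
  assumes X: "finite X" and plan: "coupling_on X \<alpha> \<beta> \<pi>"
    and c: "\<And>x. x \<in> X \<Longrightarrow> 0 \<le> c x x"
    and d: "0 \<le> d" "\<And>x y. x \<in> X \<Longrightarrow> y \<in> X \<Longrightarrow> x \<noteq> y \<Longrightarrow> d \<le> c x y"
  shows "d / 2 * (\<Sum>x\<in>X. \<bar>\<alpha> x - \<beta> x\<bar>) \<le> (\<Sum>x\<in>X. \<Sum>y\<in>X. c x y * \<pi> x y)"
proof -
  have nonneg: "0 \<le> \<pi> x y" if "x \<in> X" "y \<in> X" for x y
    using plan that by (simp add: coupling_on_def)
  have diag: "\<pi> x x \<le> min (\<alpha> x) (\<beta> x)" if "x \<in> X" for x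
  proof -
    have "\<pi> x x \<le> (\<Sum>y\<in>X. \<pi> x y)" "\<pi> x x \<le> (\<Sum>y\<in>X. \<pi> y x)"
      using X that nonneg by (auto intro: member_le_sum[of x X "\<lambda>y. \<pi> x y"] member_le_sum[of x X "\<lambda>y. \<pi> y x"])
    then show ?thesis using plan that by (simp add: coupling_on_def)
  qed
  (* Mass that does not stay in place pays at least d. *)
  have "(\<Sum>x\<in>X. \<bar>\<alpha> x - \<beta> x\<bar>) = (\<Sum>x\<in>X. \<alpha> x + \<beta> x - 2 * min (\<alpha> x) (\<beta> x))"
    by (intro sum.cong) (auto simp: min_def)
  also have "\<dots> \<le> (\<Sum>x\<in>X. \<alpha> x + \<beta> x - 2 * \<pi> x x)"
    using diag by (intro sum_mono) auto
  also have "\<dots> = 2 * ((\<Sum>x\<in>X. \<Sum>y\<in>X. \<pi> x y) - (\<Sum>x\<in>X. \<pi> x x))"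
    using coupling_on_mass[OF plan] by (simp add: sum.distrib sum_subtractf sum_distrib_left)
  finally have "d / 2 * (\<Sum>x\<in>X. \<bar>\<alpha> x - \<beta> x\<bar>)
      \<le> d / 2 * (2 * ((\<Sum>x\<in>X. \<Sum>y\<in>X. \<pi> x y) - (\<Sum>x\<in>X. \<pi> x x)))"
    using d(1) by (intro mult_left_mono) auto
  also have "\<dots> = (\<Sum>x\<in>X. \<Sum>y\<in>X. d * (\<pi> x y - (if y = x then \<pi> x x else 0)))"
    using X by (simp add: sum_subtractf flip: sum_distrib_left)
  also have "\<dots> \<le> (\<Sum>x\<in>X. \<Sum>y\<in>X. c x y * \<pi> x y)"
    using c d(2) nonneg by (intro sum_mono) (auto intro: mult_right_mono)
  finally show ?thesis .
qed

section \<open>Measurability of the optimal transport cost\<close>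

text \<open>
  With a single class, the greedy matching step uses up the residuals of a partial coupling
  completely, because both residuals have the same mass.
\<close>

lemma complete_partial_coupling:
  fixes \<alpha> \<beta> :: "'p \<Rightarrow> real" and c \<pi> :: "'p \<Rightarrow> 'p \<Rightarrow> real"
  assumes X: "finite X" and K: "0 \<le> K" "\<And>x y. x \<in> X \<Longrightarrow> y \<in> X \<Longrightarrow> c x y \<le> K"
    and mass: "(\<Sum>x\<in>X. \<alpha> x) = (\<Sum>y\<in>X. \<beta> y)"
    and nonneg: "\<And>x y. x \<in> X \<Longrightarrow> y \<in> X \<Longrightarrow> 0 \<le> \<pi> x y"
    and row: "\<And>x. x \<in> X \<Longrightarrow> (\<Sum>y\<in>X. \<pi> x y) \<le> \<alpha> x"
    and col: "\<And>y. y \<in> X \<Longrightarrow> (\<Sum>x\<in>X. \<pi> x y) \<le> \<beta> y"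
  obtains \<pi>' where "coupling_on X \<alpha> \<beta> \<pi>'"
    "(\<Sum>x\<in>X. \<Sum>y\<in>X. c x y * \<pi>' x y)
      \<le> (\<Sum>x\<in>X. \<Sum>y\<in>X. c x y * \<pi> x y) + K * ((\<Sum>x\<in>X. \<alpha> x) - (\<Sum>x\<in>X. \<Sum>y\<in>X. \<pi> x y))"
proof -
  define a where "a x = \<alpha> x - (\<Sum>y\<in>X. \<pi> x y)" for x
  define b where "b y = \<beta> y - (\<Sum>x\<in>X. \<pi> x y)" for y
  have ab: "(\<Sum>x\<in>X. a x) = (\<Sum>x\<in>X. \<alpha> x) - (\<Sum>x\<in>X. \<Sum>y\<in>X. \<pi> x y)"
    "(\<Sum>x\<in>X. b x) = (\<Sum>x\<in>X. \<alpha> x) - (\<Sum>x\<in>X. \<Sum>y\<in>X. \<pi> x y)"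
    using sum.swap[of "\<lambda>x y. \<pi> x y" X X] mass by (simp_all add: a_def b_def sum_subtractf)
  obtain \<rho> where r: "\<And>x y. x \<in> X \<Longrightarrow> y \<in> X \<Longrightarrow> 0 \<le> \<rho> x y"
    "\<And>x. x \<in> X \<Longrightarrow> (\<Sum>y\<in>X. \<rho> x y) \<le> a x"
    "\<And>y. y \<in> X \<Longrightarrow> (\<Sum>x\<in>X. \<rho> x y) \<le> b y"
    "\<And>i. (\<Sum>x | x \<in> X \<and> () = i. a x - (\<Sum>y\<in>X. \<rho> x y))
          = max (\<Sum>x | x \<in> X \<and> () = i. a x - b x) 0"
    "\<And>i. (\<Sum>y | y \<in> X \<and> () = i. b y - (\<Sum>x\<in>X. \<rho> x y))
          = max (- (\<Sum>x | x \<in> X \<and> () = i. a x - b x)) 0"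
    "(\<Sum>x\<in>X. \<Sum>y\<in>X. c x y * \<rho> x y) \<le> K / 2 * (\<Sum>x\<in>X. a x + b x)"
  proof (rule classwise_matching[of X a b K "\<lambda>_. ()" c, OF X])
    show "0 \<le> a x" if "x \<in> X" for x using row[OF that] by (simp add: a_def)
    show "0 \<le> b y" if "y \<in> X" for y using col[OF that] by (simp add: b_def)
  qed (use K in blast)+
  have "coupling_on X \<alpha> \<beta> (\<lambda>x y. \<pi> x y + \<rho> x y)"
  proof (rule partial_coupling_without_residual[OF X])
    show "0 \<le> \<pi> x y + \<rho> x y" if "x \<in> X" "y \<in> X" for x y
      using nonneg r(1) that by simp
    show "(\<Sum>y\<in>X. \<pi> x y + \<rho> x y) \<le> \<alpha> x" if "x \<in> X" for x
      using r(2)[OF that] by (simp add: sum.distrib a_def)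
    show "(\<Sum>x\<in>X. \<pi> x y + \<rho> x y) \<le> \<beta> y" if "y \<in> X" for y
      using r(3)[OF that] by (simp add: sum.distrib b_def)
    show "(\<Sum>x\<in>X. \<alpha> x - (\<Sum>y\<in>X. \<pi> x y + \<rho> x y)) = 0"
      using r(4)[of "()"] ab by (simp add: sum.distrib sum_subtractf a_def)
    show "(\<Sum>y\<in>X. \<beta> y - (\<Sum>x\<in>X. \<pi> x y + \<rho> x y)) = 0"
      using r(5)[of "()"] ab by (simp add: sum.distrib sum_subtractf b_def)
  qed
  moreover have "(\<Sum>x\<in>X. \<Sum>y\<in>X. c x y * (\<pi> x y + \<rho> x y))
      \<le> (\<Sum>x\<in>X. \<Sum>y\<in>X. c x y * \<pi> x y) + K * ((\<Sum>x\<in>X. \<alpha> x) - (\<Sum>x\<in>X. \<Sum>y\<in>X. \<pi> x y))"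
    using r(6) by (simp add: sum.distrib distrib_left right_diff_distrib ab)
  ultimately show thesis by (rule that)
qed

text \<open>
  Repairing wrong marginals costs no more than \<open>K\<close>, a bound for all distances, times the summed
  absolute errors of the marginals: shrink the rows and the columns that are too heavy, then complete
  the partial coupling. So the marginal constraints may be replaced by a penalty without changing the
  infimum.
\<close>

lemma coupling_near_plan:
  fixes \<alpha> \<beta> :: "'p \<Rightarrow> real" and c \<pi> :: "'p \<Rightarrow> 'p \<Rightarrow> real"
  assumes X: "finite X"
    and c: "\<And>x y. x \<in> X \<Longrightarrow> y \<in> X \<Longrightarrow> 0 \<le> c x y"
    and K: "0 \<le> K" "\<And>x y. x \<in> X \<Longrightarrow> y \<in> X \<Longrightarrow> c x y \<le> K"
    and \<alpha>: "\<And>x. x \<in> X \<Longrightarrow> 0 \<le> \<alpha> x" and \<beta>: "\<And>x. x \<in> X \<Longrightarrow> 0 \<le> \<beta> x"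
    and mass: "(\<Sum>x\<in>X. \<alpha> x) = (\<Sum>y\<in>X. \<beta> y)"
    and nonneg: "\<And>x y. x \<in> X \<Longrightarrow> y \<in> X \<Longrightarrow> 0 \<le> \<pi> x y"
  obtains \<pi>' where "coupling_on X \<alpha> \<beta> \<pi>'"
    "(\<Sum>x\<in>X. \<Sum>y\<in>X. c x y * \<pi>' x y)
      \<le> (\<Sum>x\<in>X. \<Sum>y\<in>X. c x y * \<pi> x y)
        + K * ((\<Sum>x\<in>X. \<bar>\<alpha> x - (\<Sum>y\<in>X. \<pi> x y)\<bar>) + (\<Sum>y\<in>X. \<bar>\<beta> y - (\<Sum>x\<in>X. \<pi> x y)\<bar>))"
proof -
  define R where "R x = (\<Sum>y\<in>X. \<pi> x y)" for x
  define C where "C y = (\<Sum>x\<in>X. \<pi> x y)" for y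
  (* Shrinking factors that bring the row sums below \<alpha> and the column sums below \<beta>. *)
  define s where "s x = (if R x \<le> \<alpha> x then 1 else \<alpha> x / R x)" for x
  define t where "t y = (if C y \<le> \<beta> y then 1 else \<beta> y / C y)" for y
  define \<pi>1 where "\<pi>1 x y = \<pi> x y * s x * t y" for x y
  have s: "0 \<le> s x" "s x \<le> 1" "R x * s x = min (R x) (\<alpha> x)" if "x \<in> X" for x
    using \<alpha>[OF that] by (auto simp: s_def min_def divide_le_eq)
  have t: "0 \<le> t y" "t y \<le> 1" "C y * t y = min (C y) (\<beta> y)" if "y \<in> X" for y
    using \<beta>[OF that] by (auto simp: t_def min_def divide_le_eq)
  have le_s: "\<pi>1 x y \<le> \<pi> x y * s x" and le_t: "\<pi>1 x y \<le> \<pi> x y * t y"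
    and ge: "\<pi> x y * s x + \<pi> x y * t y - \<pi> x y \<le> \<pi>1 x y" and pos: "0 \<le> \<pi>1 x y"
    and le: "\<pi>1 x y \<le> \<pi> x y"
    if "x \<in> X" "y \<in> X" for x y
  proof -
    note p = nonneg[OF that] and sx = s(1,2)[OF that(1)] and ty = t(1,2)[OF that(2)]
    show "\<pi>1 x y \<le> \<pi> x y * s x"
      unfolding \<pi>1_def using mult_left_mono[OF ty(2), of "\<pi> x y * s x"] p sx by simp
    also have "\<dots> \<le> \<pi> x y"
      using mult_left_mono[OF sx(2) p] by simp
    finally show "\<pi>1 x y \<le> \<pi> x y" .
    show "\<pi>1 x y \<le> \<pi> x y * t y"
      unfolding \<pi>1_def using mult_left_mono[OF sx(2), of "\<pi> x y * t y"] p ty by (simp add: mult_ac)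
    show "0 \<le> \<pi>1 x y" unfolding \<pi>1_def using p sx ty by simp
    have "0 \<le> \<pi> x y * ((1 - s x) * (1 - t y))" using p sx ty by simp
    then show "\<pi> x y * s x + \<pi> x y * t y - \<pi> x y \<le> \<pi>1 x y"
      by (simp add: \<pi>1_def algebra_simps)
  qed
  have row: "(\<Sum>y\<in>X. \<pi>1 x y) \<le> \<alpha> x" if "x \<in> X" for x
  proof -
    have "(\<Sum>y\<in>X. \<pi>1 x y) \<le> (\<Sum>y\<in>X. \<pi> x y * s x)" using that by (intro sum_mono le_s)
    also have "\<dots> = R x * s x" by (simp add: R_def sum_distrib_right)
    finally show ?thesis using s(3)[OF that] by simp
  qed
  have col: "(\<Sum>x\<in>X. \<pi>1 x y) \<le> \<beta> y" if "y \<in> X" for y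
  proof -
    have "(\<Sum>x\<in>X. \<pi>1 x y) \<le> (\<Sum>x\<in>X. \<pi> x y * t y)" using that by (intro sum_mono le_t)
    also have "\<dots> = C y * t y" by (simp add: C_def sum_distrib_right)
    finally show ?thesis using t(3)[OF that] by simp
  qed
  obtain \<pi>' where \<pi>': "coupling_on X \<alpha> \<beta> \<pi>'"
    "(\<Sum>x\<in>X. \<Sum>y\<in>X. c x y * \<pi>' x y)
      \<le> (\<Sum>x\<in>X. \<Sum>y\<in>X. c x y * \<pi>1 x y) + K * ((\<Sum>x\<in>X. \<alpha> x) - (\<Sum>x\<in>X. \<Sum>y\<in>X. \<pi>1 x y))"
    using complete_partial_coupling[of X K c \<alpha> \<beta> \<pi>1, OF X K mass pos row col] by blast
  (* By s t >= s + t - 1, the mass lost by the double shrinking is at most the sum of the two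
     individual losses. *)
  have "(\<Sum>x\<in>X. min (R x) (\<alpha> x)) + (\<Sum>y\<in>X. min (C y) (\<beta> y)) - (\<Sum>y\<in>X. C y)
      = (\<Sum>x\<in>X. \<Sum>y\<in>X. \<pi> x y * s x) + (\<Sum>x\<in>X. \<Sum>y\<in>X. \<pi> x y * t y) - (\<Sum>x\<in>X. \<Sum>y\<in>X. \<pi> x y)"
  proof -
    have 1: "(\<Sum>x\<in>X. min (R x) (\<alpha> x)) = (\<Sum>x\<in>X. \<Sum>y\<in>X. \<pi> x y * s x)"
    proof (intro sum.cong refl)
      fix x assume "x \<in> X"
      then show "min (R x) (\<alpha> x) = (\<Sum>y\<in>X. \<pi> x y * s x)"
        using s(3)[of x] by (simp add: R_def sum_distrib_right)
    qed
    have "(\<Sum>y\<in>X. min (C y) (\<beta> y)) = (\<Sum>y\<in>X. \<Sum>x\<in>X. \<pi> x y * t y)"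
    proof (intro sum.cong refl)
      fix y assume "y \<in> X"
      then show "min (C y) (\<beta> y) = (\<Sum>x\<in>X. \<pi> x y * t y)"
        using t(3)[of y] by (simp add: C_def sum_distrib_right)
    qed
    also have "\<dots> = (\<Sum>x\<in>X. \<Sum>y\<in>X. \<pi> x y * t y)" by (rule sum.swap)
    finally show ?thesis
      using 1 sum.swap[of \<pi> X X] by (simp add: C_def)
  qed
  also have "\<dots> = (\<Sum>x\<in>X. \<Sum>y\<in>X. \<pi> x y * s x + \<pi> x y * t y - \<pi> x y)"
    by (simp add: sum.distrib sum_subtractf)
  also have "\<dots> \<le> (\<Sum>x\<in>X. \<Sum>y\<in>X. \<pi>1 x y)"
    by (intro sum_mono ge)
  finally have "(\<Sum>x\<in>X. \<alpha> x) - (\<Sum>x\<in>X. \<Sum>y\<in>X. \<pi>1 x y)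
      \<le> (\<Sum>x\<in>X. \<alpha> x - min (R x) (\<alpha> x)) + (\<Sum>y\<in>X. C y - min (C y) (\<beta> y))"
    by (simp add: sum_subtractf)
  also have "\<dots> \<le> (\<Sum>x\<in>X. \<bar>\<alpha> x - R x\<bar>) + (\<Sum>y\<in>X. \<bar>\<beta> y - C y\<bar>)"
    by (intro add_mono sum_mono) (auto simp: min_def)
  finally have "K * ((\<Sum>x\<in>X. \<alpha> x) - (\<Sum>x\<in>X. \<Sum>y\<in>X. \<pi>1 x y))
      \<le> K * ((\<Sum>x\<in>X. \<bar>\<alpha> x - R x\<bar>) + (\<Sum>y\<in>X. \<bar>\<beta> y - C y\<bar>))"
    by (rule mult_left_mono[OF _ K(1)])
  moreover have "(\<Sum>x\<in>X. \<Sum>y\<in>X. c x y * \<pi>1 x y) \<le> (\<Sum>x\<in>X. \<Sum>y\<in>X. c x y * \<pi> x y)"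
    by (intro sum_mono mult_left_mono le c)
  ultimately show thesis
    using that[OF \<pi>'(1)] \<pi>'(2) unfolding R_def C_def by linarith
qed

definition penalized_cost ::
  "'p set \<Rightarrow> ('p \<Rightarrow> 'p \<Rightarrow> real) \<Rightarrow> real \<Rightarrow> ('p \<Rightarrow> real) \<Rightarrow> ('p \<Rightarrow> real) \<Rightarrow> ('p \<Rightarrow> 'p \<Rightarrow> real) \<Rightarrow> real"
where
  "penalized_cost X c K \<alpha> \<beta> \<pi> = (\<Sum>x\<in>X. \<Sum>y\<in>X. c x y * \<pi> x y)
     + K * ((\<Sum>x\<in>X. \<bar>\<alpha> x - (\<Sum>y\<in>X. \<pi> x y)\<bar>) + (\<Sum>y\<in>X. \<bar>\<beta> y - (\<Sum>x\<in>X. \<pi> x y)\<bar>))"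

text \<open>
  Arbitrary nonnegative rational matrices, with no condition on the marginals. The extensional function
  spaces make the set countable.
\<close>

definition rational_plans :: "'p set \<Rightarrow> ('p \<Rightarrow> 'p \<Rightarrow> real) set" where
  "rational_plans X = PiE X (\<lambda>_. PiE X (\<lambda>_. \<rat> \<inter> {0..}))"

lemma countable_rational_plans: "finite X \<Longrightarrow> countable (rational_plans X)"
  unfolding rational_plans_def by (intro countable_PiE countable_Int1 countable_rat) auto

lemma rational_plans_nonneg: "\<pi> \<in> rational_plans X \<Longrightarrow> x \<in> X \<Longrightarrow> y \<in> X \<Longrightarrow> 0 \<le> \<pi> x y"
  unfolding rational_plans_def by (auto simp: PiE_iff)

lemma penalized_cost_perturb:
  assumes X: "finite X" and K: "0 \<le> K" "\<And>x y. x \<in> X \<Longrightarrow> y \<in> X \<Longrightarrow> c x y \<le> K"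
    and plan: "coupling_on X \<alpha> \<beta> \<pi>"
    and close: "\<And>x y. x \<in> X \<Longrightarrow> y \<in> X \<Longrightarrow> \<pi> x y \<le> r x y \<and> r x y \<le> \<pi> x y + e"
  shows "penalized_cost X c K \<alpha> \<beta> r
    \<le> (\<Sum>x\<in>X. \<Sum>y\<in>X. c x y * \<pi> x y) + 3 * K * (real (card X))\<^sup>2 * e"
proof -
  let ?N = "real (card X)"
  have "(\<Sum>x\<in>X. \<Sum>y\<in>X. c x y * r x y) \<le> (\<Sum>x\<in>X. \<Sum>y\<in>X. c x y * \<pi> x y + K * e)"
  proof (intro sum_mono)
    fix x y assume xy: "x \<in> X" "y \<in> X"
    have "c x y * (r x y - \<pi> x y) \<le> K * (r x y - \<pi> x y)"
      using K(2)[OF xy] close[OF xy] by (intro mult_right_mono) auto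
    also have "\<dots> \<le> K * e" using K(1) close[OF xy] by (intro mult_left_mono) auto
    finally show "c x y * r x y \<le> c x y * \<pi> x y + K * e" by (simp add: right_diff_distrib)
  qed
  also have "\<dots> = (\<Sum>x\<in>X. \<Sum>y\<in>X. c x y * \<pi> x y) + ?N * (?N * (K * e))"
    by (simp add: sum.distrib)
  finally have 1: "(\<Sum>x\<in>X. \<Sum>y\<in>X. c x y * r x y)
    \<le> (\<Sum>x\<in>X. \<Sum>y\<in>X. c x y * \<pi> x y) + ?N * (?N * (K * e))" .
  have "(\<Sum>x\<in>X. \<bar>\<alpha> x - (\<Sum>y\<in>X. r x y)\<bar>) \<le> (\<Sum>x\<in>X. ?N * e)"
  proof (intro sum_mono)
    fix x assume x: "x \<in> X"
    have "\<bar>\<alpha> x - (\<Sum>y\<in>X. r x y)\<bar> = \<bar>\<Sum>y\<in>X. \<pi> x y - r x y\<bar>"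
      using plan x by (simp add: coupling_on_def sum_subtractf)
    also have "\<dots> \<le> (\<Sum>y\<in>X. \<bar>\<pi> x y - r x y\<bar>)" by (rule sum_abs)
    also have "\<dots> \<le> (\<Sum>y\<in>X. e)" using close x by (intro sum_mono) fastforce
    finally show "\<bar>\<alpha> x - (\<Sum>y\<in>X. r x y)\<bar> \<le> ?N * e" by simp
  qed
  moreover have "(\<Sum>y\<in>X. \<bar>\<beta> y - (\<Sum>x\<in>X. r x y)\<bar>) \<le> (\<Sum>y\<in>X. ?N * e)"
  proof (intro sum_mono)
    fix y assume y: "y \<in> X"
    have "\<bar>\<beta> y - (\<Sum>x\<in>X. r x y)\<bar> = \<bar>\<Sum>x\<in>X. \<pi> x y - r x y\<bar>"
      using plan y by (simp add: coupling_on_def sum_subtractf)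
    also have "\<dots> \<le> (\<Sum>x\<in>X. \<bar>\<pi> x y - r x y\<bar>)" by (rule sum_abs)
    also have "\<dots> \<le> (\<Sum>x\<in>X. e)" using close y by (intro sum_mono) fastforce
    finally show "\<bar>\<beta> y - (\<Sum>x\<in>X. r x y)\<bar> \<le> ?N * e" by simp
  qed
  ultimately have "K * ((\<Sum>x\<in>X. \<bar>\<alpha> x - (\<Sum>y\<in>X. r x y)\<bar>) + (\<Sum>y\<in>X. \<bar>\<beta> y - (\<Sum>x\<in>X. r x y)\<bar>))
      \<le> K * (?N * (?N * e) + ?N * (?N * e))"
    using K(1) by (intro mult_left_mono add_mono) auto
  then show ?thesis
    using 1 unfolding penalized_cost_def by (simp add: power2_eq_square algebra_simps)
qed

text \<open>
  The transport problem as an infimum over a fixed countable set. The set of couplings varies with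
  the marginals and is in general uncountable; after the penalty has absorbed the constraints, the objective is
  continuous in the matrix, and the rational matrices suffice.
\<close>

lemma transport_cost_eq_penalized:
  assumes X: "finite X" and c: "\<And>x y. x \<in> X \<Longrightarrow> y \<in> X \<Longrightarrow> 0 \<le> c x y"
    and K: "0 \<le> K" "\<And>x y. x \<in> X \<Longrightarrow> y \<in> X \<Longrightarrow> c x y \<le> K"
    and \<alpha>: "\<And>x. x \<in> X \<Longrightarrow> 0 \<le> \<alpha> x" and \<beta>: "\<And>x. x \<in> X \<Longrightarrow> 0 \<le> \<beta> x"
    and mass: "(\<Sum>x\<in>X. \<alpha> x) = (\<Sum>y\<in>X. \<beta> y)"
  shows "(INF \<pi>\<in>Collect (coupling_on X \<alpha> \<beta>). \<Sum>x\<in>X. \<Sum>y\<in>X. c x y * \<pi> x y)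
    = (INF r\<in>rational_plans X. penalized_cost X c K \<alpha> \<beta> r)"
proof (rule antisym)
  let ?cost = "\<lambda>\<pi>. \<Sum>x\<in>X. \<Sum>y\<in>X. c x y * \<pi> x y"
  have near: "\<exists>\<pi>'. coupling_on X \<alpha> \<beta> \<pi>' \<and> ?cost \<pi>' \<le> penalized_cost X c K \<alpha> \<beta> \<pi>"
    if "\<And>x y. x \<in> X \<Longrightarrow> y \<in> X \<Longrightarrow> 0 \<le> \<pi> x y" for \<pi>
    using coupling_near_plan[of X c K \<alpha> \<beta> \<pi>, OF X c K \<alpha> \<beta> mass that]
    unfolding penalized_cost_def by blast
  have bdd: "bdd_below (?cost ` Collect (coupling_on X \<alpha> \<beta>))"
    by (rule bdd_belowI[of _ 0]) (auto simp: coupling_on_def intro!: sum_nonneg mult_nonneg_nonneg c)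
  have bdd': "bdd_below (penalized_cost X c K \<alpha> \<beta> ` rational_plans X)"
  proof (rule bdd_belowI[of _ 0])
    fix z assume "z \<in> penalized_cost X c K \<alpha> \<beta> ` rational_plans X"
    then obtain r where r: "r \<in> rational_plans X" and z: "z = penalized_cost X c K \<alpha> \<beta> r" by blast
    show "0 \<le> z"
      unfolding z penalized_cost_def using K(1)
      by (intro add_nonneg_nonneg sum_nonneg mult_nonneg_nonneg c rational_plans_nonneg[OF r]) auto
  qed
  have "(\<lambda>x\<in>X. \<lambda>y\<in>X. 0) \<in> rational_plans X"
    unfolding rational_plans_def by auto
  then have ne: "rational_plans X \<noteq> {}" by blast
  show "(INF \<pi>\<in>Collect (coupling_on X \<alpha> \<beta>). ?cost \<pi>)
    \<le> (INF r\<in>rational_plans X. penalized_cost X c K \<alpha> \<beta> r)"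
  proof (rule cINF_greatest[OF ne])
    fix r assume r: "r \<in> rational_plans X"
    have "\<exists>\<pi>'. coupling_on X \<alpha> \<beta> \<pi>' \<and> ?cost \<pi>' \<le> penalized_cost X c K \<alpha> \<beta> r"
      by (rule near) (rule rational_plans_nonneg[OF r])
    then obtain \<pi>' where p: "coupling_on X \<alpha> \<beta> \<pi>'" "?cost \<pi>' \<le> penalized_cost X c K \<alpha> \<beta> r"
      by blast
    then show "(INF \<pi>\<in>Collect (coupling_on X \<alpha> \<beta>). ?cost \<pi>) \<le> penalized_cost X c K \<alpha> \<beta> r"
      using cINF_lower[OF bdd, of \<pi>'] by simp
  qed
  have "Collect (coupling_on X \<alpha> \<beta>) \<noteq> {}"
    using near[of "\<lambda>_ _. 0"] by auto
  then show "(INF r\<in>rational_plans X. penalized_cost X c K \<alpha> \<beta> r)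
    \<le> (INF \<pi>\<in>Collect (coupling_on X \<alpha> \<beta>). ?cost \<pi>)"
  proof (rule cINF_greatest)
    fix \<pi> assume "\<pi> \<in> Collect (coupling_on X \<alpha> \<beta>)"
    then have plan: "coupling_on X \<alpha> \<beta> \<pi>" by simp
    show "(INF r\<in>rational_plans X. penalized_cost X c K \<alpha> \<beta> r) \<le> ?cost \<pi>"
    proof (rule field_le_epsilon)
      fix e :: real assume e: "0 < e"
      (* The summand 1 keeps the denominator positive when K = 0 or X is empty. *)
      define e' where "e' = e / (3 * K * (real (card X))\<^sup>2 + 1)"
      have e': "0 < e'" using e K(1) unfolding e'_def by (intro divide_pos_pos) (auto intro: add_nonneg_pos)
      have "\<exists>s\<in>\<rat>. \<pi> x y < s \<and> s < \<pi> x y + e'" for x y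
        using Rats_dense_in_real[of "\<pi> x y" "\<pi> x y + e'"] e' by auto
      then obtain s where s: "\<And>x y. s x y \<in> \<rat> \<and> \<pi> x y < s x y \<and> s x y < \<pi> x y + e'" by metis
      define r where "r = (\<lambda>x\<in>X. \<lambda>y\<in>X. s x y)"
      have "0 \<le> s x y" if "x \<in> X" "y \<in> X" for x y
        using plan s[of x y] that by (force simp: coupling_on_def)
      then have "r \<in> rational_plans X"
        using s unfolding rational_plans_def r_def by auto
      then have "(INF r\<in>rational_plans X. penalized_cost X c K \<alpha> \<beta> r) \<le> penalized_cost X c K \<alpha> \<beta> r"
        by (rule cINF_lower[OF bdd'])
      also have "\<dots> \<le> ?cost \<pi> + 3 * K * (real (card X))\<^sup>2 * e'"
        using s by (intro penalized_cost_perturb X K plan) (auto simp: r_def less_imp_le)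
      also have "3 * K * (real (card X))\<^sup>2 * e' \<le> e"
      proof -
        have pos: "0 < 3 * K * (real (card X))\<^sup>2 + 1" using K(1) by (auto intro: add_nonneg_pos)
        have "3 * K * (real (card X))\<^sup>2 * e' \<le> (3 * K * (real (card X))\<^sup>2 + 1) * e'"
          using e' by (simp add: distrib_right)
        also have "\<dots> = e" unfolding e'_def using pos by simp
        finally show ?thesis .
      qed
      finally show "(INF r\<in>rational_plans X. penalized_cost X c K \<alpha> \<beta> r) \<le> ?cost \<pi> + e" by simp
    qed
  qed
qed

text \<open>
  If the masses differ there are no couplings and the value is the constant \<open>Inf {}\<close>; otherwise the
  value is a countable infimum of functions that are measurable in the marginals.
\<close>

lemma borel_measurable_transport_cost:
  fixes \<alpha> \<beta> :: "'a \<Rightarrow> 'p \<Rightarrow> real"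
  assumes X: "finite X" and c: "\<And>x y. x \<in> X \<Longrightarrow> y \<in> X \<Longrightarrow> 0 \<le> c x y"
    and \<alpha>: "\<And>\<omega> x. x \<in> X \<Longrightarrow> 0 \<le> \<alpha> \<omega> x" and \<beta>: "\<And>\<omega> x. x \<in> X \<Longrightarrow> 0 \<le> \<beta> \<omega> x"
    and m\<alpha>: "\<And>x. x \<in> X \<Longrightarrow> (\<lambda>\<omega>. \<alpha> \<omega> x) \<in> borel_measurable M"
    and m\<beta>: "\<And>x. x \<in> X \<Longrightarrow> (\<lambda>\<omega>. \<beta> \<omega> x) \<in> borel_measurable M"
  shows "(\<lambda>\<omega>. INF \<pi>\<in>Collect (coupling_on X (\<alpha> \<omega>) (\<beta> \<omega>)). \<Sum>x\<in>X. \<Sum>y\<in>X. c x y * \<pi> x y)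
    \<in> borel_measurable M"
proof -
  (* Any common upper bound of the costs will do. *)
  define K where "K = (\<Sum>x\<in>X. \<Sum>y\<in>X. c x y)"
  have K0: "0 \<le> K" unfolding K_def by (intro sum_nonneg c)
  have K: "c x y \<le> K" if "x \<in> X" "y \<in> X" for x y
  proof -
    have "c x y \<le> (\<Sum>y\<in>X. c x y)"
      by (rule member_le_sum[OF that(2) _ X]) (use c that in auto)
    also have "\<dots> \<le> K" unfolding K_def
      by (rule member_le_sum[OF that(1) _ X]) (use c in \<open>auto intro: sum_nonneg\<close>)
    finally show ?thesis .
  qed
  have empty: "Collect (coupling_on X (\<alpha> \<omega>) (\<beta> \<omega>)) = {}"
    if "(\<Sum>x\<in>X. \<alpha> \<omega> x) \<noteq> (\<Sum>x\<in>X. \<beta> \<omega> x)" for \<omega>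
  proof -
    have "\<not> coupling_on X (\<alpha> \<omega>) (\<beta> \<omega>) \<pi>" for \<pi>
      using that coupling_on_mass[of X "\<alpha> \<omega>" "\<beta> \<omega>" \<pi>] by argo
    then show ?thesis by blast
  qed
  have "(\<lambda>\<omega>. INF \<pi>\<in>Collect (coupling_on X (\<alpha> \<omega>) (\<beta> \<omega>)). \<Sum>x\<in>X. \<Sum>y\<in>X. c x y * \<pi> x y)
    = (\<lambda>\<omega>. if (\<Sum>x\<in>X. \<alpha> \<omega> x) = (\<Sum>x\<in>X. \<beta> \<omega> x)
        then INF r\<in>rational_plans X. penalized_cost X c K (\<alpha> \<omega>) (\<beta> \<omega>) r else Inf {})"
  proof (rule ext)
    fix \<omega>
    show "(INF \<pi>\<in>Collect (coupling_on X (\<alpha> \<omega>) (\<beta> \<omega>)). \<Sum>x\<in>X. \<Sum>y\<in>X. c x y * \<pi> x y)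
      = (if (\<Sum>x\<in>X. \<alpha> \<omega> x) = (\<Sum>x\<in>X. \<beta> \<omega> x)
        then INF r\<in>rational_plans X. penalized_cost X c K (\<alpha> \<omega>) (\<beta> \<omega>) r else Inf {})"
    proof (cases "(\<Sum>x\<in>X. \<alpha> \<omega> x) = (\<Sum>x\<in>X. \<beta> \<omega> x)")
      case True
      then show ?thesis
        using transport_cost_eq_penalized[of X c K "\<alpha> \<omega>" "\<beta> \<omega>", OF X c K0 K \<alpha> \<beta>] by simp
    next
      case False
      show ?thesis unfolding empty[OF False] using False by simp
    qed
  qed
  moreover have "(\<lambda>\<omega>. INF r\<in>rational_plans X. penalized_cost X c K (\<alpha> \<omega>) (\<beta> \<omega>) r) \<in> borel_measurable M"
    unfolding penalized_cost_def
    by (intro borel_measurable_cINF_real countable_rational_plans X borel_measurable_add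
        borel_measurable_times borel_measurable_sum borel_measurable_abs borel_measurable_diff
        borel_measurable_const m\<alpha> m\<beta>)
  moreover have "{\<omega> \<in> space M. (\<Sum>x\<in>X. \<alpha> \<omega> x) = (\<Sum>x\<in>X. \<beta> \<omega> x)} \<in> sets M"
    by (intro borel_measurable_eq borel_measurable_sum m\<alpha> m\<beta>)
  ultimately show ?thesis
    by (simp only:) (rule measurable_If, assumption, rule borel_measurable_const, assumption)
qed

section \<open>Dyadic blocks of the pixel grid\<close>

lemma grid_image: "grid n = (\<lambda>(i, j). (real i / real n, real j / real n)) ` ({..<n} \<times> {..<n})"
  unfolding grid_def by auto

lemma finite_grid [simp]: "finite (grid n)"
  unfolding grid_image by simp

lemma card_grid: "card (grid n) = n\<^sup>2"
proof -
  have "inj_on (\<lambda>(i, j). (real i / real n, real j / real n)) ({..<n} \<times> {..<n})"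
    by (auto intro!: inj_onI)
  then show ?thesis
    unfolding grid_image by (simp add: card_image power2_eq_square)
qed

lemma torus_dist_refl [simp]: "torus_dist x x = 0"
  by (simp add: torus_dist_def)

lemma torus_dist_nonneg [simp]: "0 \<le> torus_dist x y"
  by (simp add: torus_dist_def)

lemma torus_dist_ge:
  assumes "x \<in> grid n" "y \<in> grid n" "x \<noteq> y"
  shows "1 / real n \<le> torus_dist x y"
proof -
  have coord: "1 / real n \<le> min \<bar>real i / real n - real j / real n\<bar> (1 - \<bar>real i / real n - real j / real n\<bar>)"
    if "i < n" "j < n" "i \<noteq> j" for i j
  proof -
    have n: "0 < real n" using that by simp
    have "1 \<le> \<bar>real i - real j\<bar>" "1 \<le> real n - \<bar>real i - real j\<bar>"
      using that by linarith+
    then have "1 / real n \<le> \<bar>real i - real j\<bar> / real n"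
      "1 / real n \<le> (real n - \<bar>real i - real j\<bar>) / real n"
      using n by (intro divide_right_mono; simp)+
    moreover have "\<bar>real i / real n - real j / real n\<bar> = \<bar>real i - real j\<bar> / real n"
      by (simp flip: diff_divide_distrib)
    ultimately show ?thesis
      using n by (simp add: diff_divide_distrib)
  qed
  obtain i j i' j' where ij: "i < n" "j < n" "i' < n" "j' < n"
    and x: "x = (real i / real n, real j / real n)" and y: "y = (real i' / real n, real j' / real n)"
    using assms(1,2) unfolding grid_def by blast
  let ?a = "min \<bar>fst x - fst y\<bar> (1 - \<bar>fst x - fst y\<bar>)"
  let ?b = "min \<bar>snd x - snd y\<bar> (1 - \<bar>snd x - snd y\<bar>)"
  have "i \<noteq> i' \<or> j \<noteq> j'" using assms(3) x y by auto
  then have "1 / real n \<le> ?a \<or> 1 / real n \<le> ?b"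
    using coord[of i i'] coord[of j j'] ij by (auto simp: x y)
  then have "(1 / real n)\<^sup>2 \<le> ?a\<^sup>2 \<or> (1 / real n)\<^sup>2 \<le> ?b\<^sup>2"
    using power_mono[of "1 / real n" _ 2] by auto
  then have "(1 / real n)\<^sup>2 \<le> ?a\<^sup>2 + ?b\<^sup>2"
    using zero_le_power2[of ?a] zero_le_power2[of ?b] by linarith
  then show ?thesis
    unfolding torus_dist_def by (rule real_le_rsqrt)
qed

text \<open>
  The dyadic square of side \<open>2^k\<close> pixels that contains \<open>x\<close>, as a pair of integer indices.
\<close>

definition block :: "nat \<Rightarrow> nat \<Rightarrow> pixel \<Rightarrow> int \<times> int" where
  "block n k x = (\<lfloor>real n * fst x / 2 ^ k\<rfloor>, \<lfloor>real n * snd x / 2 ^ k\<rfloor>)"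

lemma inj_block_0: "inj_on (block n 0) (grid n)"
proof (rule inj_onI)
  fix x y assume "x \<in> grid n" "y \<in> grid n" and eq: "block n 0 x = block n 0 y"
  then obtain i j i' j' where ij: "i < n" "j < n" "i' < n" "j' < n"
    and "x = (real i / real n, real j / real n)" "y = (real i' / real n, real j' / real n)"
    unfolding grid_def by blast
  with eq show "x = y" by (simp add: block_def)
qed

lemma block_coarser: "block n k x = block n k y \<Longrightarrow> block n (Suc k) x = block n (Suc k) y"
proof -
  have "\<lfloor>z / 2 ^ Suc k\<rfloor> = \<lfloor>z / 2 ^ k\<rfloor> div 2" for z :: real
    using floor_divide_real_eq_div[of 2 "z / 2 ^ k"] by (simp add: mult.commute)
  then show "block n k x = block n k y \<Longrightarrow> block n (Suc k) x = block n (Suc k) y"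
    by (simp add: block_def)
qed

text \<open>
  The torus distance is at most the planar distance, and two coordinates with the same index differ
  by at most the side \<open>2^k / n\<close> of the block.
\<close>

lemma torus_dist_in_block:
  assumes "x \<in> grid n" "y \<in> grid n" "block n k x = block n k y"
  shows "torus_dist x y \<le> sqrt 2 * 2 ^ k / real n"
proof -
  have coord: "(min \<bar>u - v\<bar> (1 - \<bar>u - v\<bar>))\<^sup>2 \<le> (2 ^ k / real n)\<^sup>2"
    if "\<lfloor>real n * u / 2 ^ k\<rfloor> = \<lfloor>real n * v / 2 ^ k\<rfloor>" "0 \<le> u" "u < 1" "0 \<le> v" "v < 1" "0 < real n"
    for u v :: real
  proof -
    have "\<bar>real n * u / 2 ^ k - real n * v / 2 ^ k\<bar> \<le> 1"
      using that(1) by linarith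
    moreover have "real n * u / 2 ^ k - real n * v / 2 ^ k = (u - v) * (real n / 2 ^ k)"
      by (simp add: algebra_simps diff_divide_distrib)
    ultimately have "\<bar>u - v\<bar> * (real n / 2 ^ k) \<le> 1"
      by (simp add: abs_mult)
    then have "\<bar>u - v\<bar> \<le> 2 ^ k / real n"
      using \<open>0 < real n\<close> by (simp add: field_simps)
    moreover have "0 \<le> min \<bar>u - v\<bar> (1 - \<bar>u - v\<bar>)" using that by (auto simp: min_def)
    ultimately show ?thesis by (intro power_mono) auto
  qed
  have "0 < real n" "0 \<le> fst x" "fst x < 1" "0 \<le> snd x" "snd x < 1"
    "0 \<le> fst y" "fst y < 1" "0 \<le> snd y" "snd y < 1"
    using assms(1,2) unfolding grid_def by auto
  then have "(min \<bar>fst x - fst y\<bar> (1 - \<bar>fst x - fst y\<bar>))\<^sup>2 + (min \<bar>snd x - snd y\<bar> (1 - \<bar>snd x - snd y\<bar>))\<^sup>2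
      \<le> (2 ^ k / real n)\<^sup>2 + (2 ^ k / real n)\<^sup>2"
    using assms(3) by (intro add_mono coord) (auto simp: block_def)
  also have "\<dots> = 2 * (2 ^ k / real n)\<^sup>2" by simp
  finally have "torus_dist x y \<le> sqrt (2 * (2 ^ k / real n)\<^sup>2)"
    unfolding torus_dist_def by (rule real_sqrt_le_mono)
  then show ?thesis by (simp add: real_sqrt_mult)
qed

lemma block_range:
  assumes n: "n = 2 ^ \<eta>" and k: "k \<le> \<eta>"
  shows "block n k ` grid n \<subseteq> {0..<2 ^ (\<eta> - k)} \<times> {0..<2 ^ (\<eta> - k)}"
proof -
  have coord: "0 \<le> \<lfloor>real n * (real i / real n) / 2 ^ k\<rfloor> \<and> \<lfloor>real n * (real i / real n) / 2 ^ k\<rfloor> < 2 ^ (\<eta> - k)"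
    if "i < n" for i
  proof -
    have "real i < 2 ^ (\<eta> - k) * 2 ^ k"
      using that n k by (simp flip: power_add)
    then have "real i / 2 ^ k < 2 ^ (\<eta> - k)"
      by (simp add: divide_less_eq)
    then show ?thesis using that by (simp add: floor_less_iff)
  qed
  show ?thesis
    using coord unfolding grid_def block_def by auto
qed

lemma card_blocks:
  assumes "n = 2 ^ \<eta>" "k \<le> \<eta>"
  shows "real (card (block n k ` grid n)) \<le> (2 ^ (\<eta> - k))\<^sup>2"
proof -
  have "card (block n k ` grid n) \<le> card ({0..<2 ^ (\<eta> - k)::int} \<times> {0..<2 ^ (\<eta> - k)::int})"
    by (intro card_mono block_range assms) simp
  also have "\<dots> = (2 ^ (\<eta> - k))\<^sup>2" by (simp add: power2_eq_square nat_power_eq)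
  finally have "real (card (block n k ` grid n)) \<le> real ((2 ^ (\<eta> - k))\<^sup>2)" by linarith
  then show ?thesis by simp
qed

text \<open>
  The Cauchy--Schwarz inequality turns the bound on the number of blocks into a bound for the sum.
\<close>

lemma sum_sqrt_card_blocks:
  assumes n: "n = 2 ^ \<eta>" and k: "k \<le> \<eta>"
  shows "(\<Sum>i\<in>block n k ` grid n. sqrt (card {x. x \<in> grid n \<and> block n k x = i})) \<le> 2 ^ (\<eta> - k) * real n"
proof (rule power2_le_imp_le)
  let ?I = "block n k ` grid n" and ?B = "\<lambda>i. {x. x \<in> grid n \<and> block n k x = i}"
  (* The squares of the summands add up to the number of pixels. *)
  have "real (card (grid n)) = (\<Sum>i\<in>?I. real (card (?B i)))"
    using sum.image_gen[of "grid n" "\<lambda>_. 1::real" "block n k"] by simp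
  then have "(\<Sum>i\<in>?I. sqrt (card (?B i)))\<^sup>2 \<le> real (n\<^sup>2) * real (card ?I)"
    using sum_squared_le_sum_of_squares[of "\<lambda>i. sqrt (card (?B i))" ?I] by (simp add: card_grid)
  also have "\<dots> \<le> real (n\<^sup>2) * (2 ^ (\<eta> - k))\<^sup>2"
    by (intro mult_left_mono card_blocks n k) simp
  finally show "(\<Sum>i\<in>?I. sqrt (card (?B i)))\<^sup>2 \<le> (2 ^ (\<eta> - k) * real n)\<^sup>2"
    by (simp add: power_mult_distrib mult.commute)
qed simp

text \<open>
  The lower bound is the total variation estimate, with \<open>1 / n\<close> the smallest distance of two distinct
  pixels; the upper bound is the dyadic greedy matching. Both depend on the marginals only through
  their difference, so a measure common to both cancels.
\<close>

lemma grid_transport_cost_bounds: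
  assumes n: "n = 2 ^ \<eta>"
    and \<alpha>: "\<And>x. x \<in> grid n \<Longrightarrow> 0 \<le> \<alpha> x" and \<beta>: "\<And>x. x \<in> grid n \<Longrightarrow> 0 \<le> \<beta> x"
    and mass: "(\<Sum>x\<in>grid n. \<alpha> x - \<beta> x) = 0"
  defines "W \<equiv> INF \<pi>\<in>Collect (coupling_on (grid n) \<alpha> \<beta>).
      \<Sum>x\<in>grid n. \<Sum>y\<in>grid n. torus_dist x y * \<pi> x y"
  shows "1 / (2 * real n) * (\<Sum>x\<in>grid n. \<bar>\<alpha> x - \<beta> x\<bar>) \<le> W"
    and "W \<le> (\<Sum>k<\<eta>. sqrt 2 * 2 ^ k / real n *
      (\<Sum>i\<in>block n k ` grid n. \<bar>\<Sum>x | x \<in> grid n \<and> block n k x = i. \<alpha> x - \<beta> x\<bar>))"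
proof -
  let ?cost = "\<lambda>\<pi>. \<Sum>x\<in>grid n. \<Sum>y\<in>grid n. torus_dist x y * \<pi> x y"
  have top: "block n \<eta> x = (0, 0)" if "x \<in> grid n" for x
  proof -
    have "block n \<eta> x \<in> {0..<2 ^ (\<eta> - \<eta>)} \<times> {0..<2 ^ (\<eta> - \<eta>)}"
      using block_range[OF n order_refl] that by blast
    then show ?thesis by (cases "block n \<eta> x") simp
  qed
  obtain \<pi> where plan: "coupling_on (grid n) \<alpha> \<beta> \<pi>"
    and cost: "?cost \<pi> \<le> (\<Sum>k<\<eta>. sqrt 2 * 2 ^ Suc k / real n / 2 *
      (\<Sum>i\<in>block n k ` grid n. \<bar>\<Sum>x | x \<in> grid n \<and> block n k x = i. \<alpha> x - \<beta> x\<bar>))"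
  proof (rule multiscale_coupling[of "grid n" \<alpha> \<beta> torus_dist "block n" \<eta> "(0, 0)"
      "\<lambda>k. sqrt 2 * 2 ^ k / real n", OF finite_grid \<alpha> \<beta> mass])
    show "torus_dist x x = 0" for x by simp
    show "inj_on (block n 0) (grid n)" by (rule inj_block_0)
    show "block n (Suc k) x = block n (Suc k) y" if "block n k x = block n k y" for k x y
      using that by (rule block_coarser)
    show "block n \<eta> x = (0, 0)" if "x \<in> grid n" for x using that by (rule top)
    show "0 \<le> sqrt 2 * 2 ^ k / real n" for k by simp
    show "torus_dist x y \<le> sqrt 2 * 2 ^ k / real n"
      if "x \<in> grid n" "y \<in> grid n" "block n k x = block n k y" for k x y
      using that by (rule torus_dist_in_block)
  qed assumption
  have bdd: "bdd_below (?cost ` Collect (coupling_on (grid n) \<alpha> \<beta>))"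
    by (rule bdd_belowI[of _ 0])
      (auto simp: coupling_on_def intro!: sum_nonneg mult_nonneg_nonneg)
  have "W \<le> ?cost \<pi>"
    unfolding W_def using plan by (intro cINF_lower bdd) simp
  with cost show "W \<le> (\<Sum>k<\<eta>. sqrt 2 * 2 ^ k / real n *
      (\<Sum>i\<in>block n k ` grid n. \<bar>\<Sum>x | x \<in> grid n \<and> block n k x = i. \<alpha> x - \<beta> x\<bar>))"
    by simp
  show "1 / (2 * real n) * (\<Sum>x\<in>grid n. \<bar>\<alpha> x - \<beta> x\<bar>) \<le> W"
    unfolding W_def
  proof (rule cINF_greatest)
    show "Collect (coupling_on (grid n) \<alpha> \<beta>) \<noteq> {}" using plan by auto
    fix \<pi> assume "\<pi> \<in> Collect (coupling_on (grid n) \<alpha> \<beta>)"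
    then show "1 / (2 * real n) * (\<Sum>x\<in>grid n. \<bar>\<alpha> x - \<beta> x\<bar>) \<le> ?cost \<pi>"
      using transport_cost_ge_total_variation[of "grid n" \<alpha> \<beta> \<pi> torus_dist "1 / real n"]
        torus_dist_ge by simp
  qed
qed

lemma signed_wasserstein_1:
  "signed_wasserstein n 1 \<rho> \<tau> =
    (INF \<pi>\<in>Collect (coupling_on (grid n) (\<lambda>x. max (\<rho> x) 0 + max (- \<tau> x) 0)
        (\<lambda>x. max (\<tau> x) 0 + max (- \<rho> x) 0)).
      \<Sum>x\<in>grid n. \<Sum>y\<in>grid n. torus_dist x y * \<pi> x y)"
  unfolding signed_wasserstein_def wasserstein_def couplings_def coupling_on_def by simp

section \<open>Gaussian noise summed over a block\<close>

lemma real_square_ge_4: "2 \<le> n \<Longrightarrow> 4 \<le> real (n\<^sup>2)"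
  using power_mono[of 2 "real n" 2] by simp

text \<open>
  The covariance matrix is a multiple of the identity minus a multiple of the all-ones matrix.
\<close>

lemma quadratic_form_noise_cov:
  "(\<Sum>x\<in>grid n. \<Sum>y\<in>grid n. t x * noise_cov n \<sigma> x y * t y)
    = (\<sigma>\<^sup>2 + \<sigma>\<^sup>2 / (real (n\<^sup>2) - 1)) * (\<Sum>x\<in>grid n. (t x)\<^sup>2)
      - \<sigma>\<^sup>2 / (real (n\<^sup>2) - 1) * (\<Sum>x\<in>grid n. t x)\<^sup>2"
proof -
  define s where "s = \<sigma>\<^sup>2 / (real (n\<^sup>2) - 1)"
  have "(\<Sum>x\<in>grid n. \<Sum>y\<in>grid n. t x * noise_cov n \<sigma> x y * t y)
     = (\<Sum>x\<in>grid n. \<Sum>y\<in>grid n. (if x = y then (\<sigma>\<^sup>2 + s) * (t x)\<^sup>2 else 0) - s * (t x * t y))"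
    by (intro sum.cong) (auto simp: noise_cov_def s_def algebra_simps power2_eq_square)
  also have "\<dots> = (\<Sum>x\<in>grid n. (\<sigma>\<^sup>2 + s) * (t x)\<^sup>2) - s * ((\<Sum>x\<in>grid n. t x) * (\<Sum>y\<in>grid n. t y))"
    unfolding sum_product by (simp add: sum_subtractf sum_distrib_left)
  finally show ?thesis
    by (simp add: s_def power2_eq_square sum_distrib_left)
qed

text \<open>
  The variance of the noise summed over \<open>b\<close> pixels. It vanishes for \<open>b = n^2\<close>, since the total noise
  is zero.
\<close>

definition block_variance :: "nat \<Rightarrow> real \<Rightarrow> nat \<Rightarrow> real" where
  "block_variance n \<sigma> b = \<sigma>\<^sup>2 * (real b * (real (n\<^sup>2) - real b) / (real (n\<^sup>2) - 1))"

lemma block_variance_nonneg: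
  assumes "2 \<le> n" "b \<le> n\<^sup>2" shows "0 \<le> block_variance n \<sigma> b"
proof -
  have "4 \<le> real (n\<^sup>2)" by (rule real_square_ge_4[OF assms(1)])
  moreover have "real b \<le> real (n\<^sup>2)" using assms(2) by linarith
  ultimately show ?thesis unfolding block_variance_def
    by (intro mult_nonneg_nonneg divide_nonneg_nonneg) auto
qed

text \<open>
  The negative correlations can only decrease the variance below that of independent noise.
\<close>

lemma block_variance_le:
  assumes "2 \<le> n" shows "block_variance n \<sigma> b \<le> \<sigma>\<^sup>2 * real b"
proof -
  have "4 \<le> real (n\<^sup>2)" by (rule real_square_ge_4[OF assms])
  moreover have "real b * (real (n\<^sup>2) - real b) \<le> real b * (real (n\<^sup>2) - 1)"
    by (cases "b = 0") (auto intro: mult_left_mono)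
  ultimately have "real b * (real (n\<^sup>2) - real b) / (real (n\<^sup>2) - 1) \<le> real b"
    by (simp add: divide_le_eq)
  then show ?thesis unfolding block_variance_def by (intro mult_left_mono) auto
qed

lemma block_variance_1: "2 \<le> n \<Longrightarrow> block_variance n \<sigma> 1 = \<sigma>\<^sup>2"
  using real_square_ge_4[of n] by (simp add: block_variance_def)

lemma distr_noise_sum:
  assumes noise: "zero_sum_gaussian_noise M n \<sigma> \<epsilon>" and n: "2 \<le> n" and B: "B \<subseteq> grid n"
  shows "distr M borel (\<lambda>\<omega>. \<Sum>x\<in>B. \<epsilon> \<omega> x) = normal_law 0 (block_variance n \<sigma> (card B))"
proof -
  let ?t = "indicator B :: pixel \<Rightarrow> real"
  have meas: "\<epsilon> \<in> measurable M (grid_vectors n)"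
    using noise by (simp add: zero_sum_gaussian_noise_def)
  have sum: "(\<Sum>x\<in>grid n. ?t x * f x) = (\<Sum>x\<in>B. f x)" for f :: "pixel \<Rightarrow> real"
    using sum.inter_restrict[of "grid n" f B] B
    by (simp add: indicator_def of_bool_def if_distrib[of "\<lambda>u. u * _"] Int_absorb1 cong: if_cong)
  have N1: "real (n\<^sup>2) - 1 > 0"
    using real_square_ge_4[OF n] by simp
  have lin: "(\<lambda>z. \<Sum>x\<in>grid n. ?t x * z x) \<in> borel_measurable (grid_vectors n)"
    by (intro borel_measurable_sum borel_measurable_times borel_measurable_const
        measurable_component_singleton)
  have "distr M borel (\<lambda>\<omega>. \<Sum>x\<in>B. \<epsilon> \<omega> x)
      = distr (distr M (grid_vectors n) \<epsilon>) borel (\<lambda>z. \<Sum>x\<in>grid n. ?t x * z x)"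
    by (subst distr_distr[OF lin meas]) (simp add: comp_def sum)
  also have "\<dots> = normal_law 0 (\<Sum>x\<in>grid n. \<Sum>y\<in>grid n. ?t x * noise_cov n \<sigma> x y * ?t y)"
    using noise unfolding zero_sum_gaussian_noise_def centred_mvnormal_def by blast
  also have "(\<Sum>x\<in>grid n. \<Sum>y\<in>grid n. ?t x * noise_cov n \<sigma> x y * ?t y) = block_variance n \<sigma> (card B)"
  proof -
    have "(\<Sum>x\<in>grid n. ?t x) = real (card B)" "(\<Sum>x\<in>grid n. (?t x)\<^sup>2) = real (card B)"
      using sum[of "\<lambda>_. 1"] sum[of ?t] by (simp_all add: power2_eq_square)
    moreover have "(s + s / d) * b - s / d * b\<^sup>2 = s * (b * (d + 1 - b) / d)"
      if "0 < d" for s b d :: real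
      using that by (simp add: field_simps power2_eq_square)
    note this[OF N1, of "\<sigma>\<^sup>2" "real (card B)"]
    ultimately show ?thesis
      unfolding quadratic_form_noise_cov block_variance_def by simp
  qed
  finally show ?thesis .
qed

text \<open>
  The mean absolute value of a centred normal variable with variance \<open>2 * v\<close>. The degenerate case
  \<open>v = 0\<close> is included because the sum over the whole grid has variance zero.
\<close>

lemma (in prob_space) abs_diff_normal_law:
  assumes indep: "indep_var borel X borel Y" and v: "0 \<le> v"
    and X: "distr M borel X = normal_law 0 v" and Y: "distr M borel Y = normal_law 0 v"
  shows "integrable M (\<lambda>\<omega>. \<bar>X \<omega> - Y \<omega>\<bar>)" and "expectation (\<lambda>\<omega>. \<bar>X \<omega> - Y \<omega>\<bar>) = 2 * sqrt (v / pi)"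
proof -
  have [measurable]: "X \<in> borel_measurable M" "Y \<in> borel_measurable M"
    using indep_var_rv1[OF indep] indep_var_rv2[OF indep] by auto
  have "integrable M (\<lambda>\<omega>. \<bar>X \<omega> - Y \<omega>\<bar>) \<and> expectation (\<lambda>\<omega>. \<bar>X \<omega> - Y \<omega>\<bar>) = 2 * sqrt (v / pi)"
  proof (cases "v = 0")
    case True
    have zero: "AE \<omega> in M. Z \<omega> = 0" if "distr M borel Z = normal_law 0 v" "Z \<in> borel_measurable M" for Z
    proof -
      have "AE z in return borel (0::real). z = 0"
        by (subst AE_return) auto
      moreover have "distr M borel Z = return borel 0"
        using True that(1) by (simp add: normal_law_def)
      ultimately have "AE z in distr M borel Z. z = 0"
        by (simp only:)
      then show ?thesis by (subst (asm) AE_distr_iff) (use that(2) in auto)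
    qed
    have AE: "AE \<omega> in M. \<bar>X \<omega> - Y \<omega>\<bar> = 0"
      using zero[OF X] zero[OF Y] by auto
    have "integrable M (\<lambda>\<omega>. \<bar>X \<omega> - Y \<omega>\<bar>) \<longleftrightarrow> integrable M (\<lambda>\<omega>. 0::real)"
      using AE by (intro integrable_cong_AE) auto
    moreover have "expectation (\<lambda>\<omega>. \<bar>X \<omega> - Y \<omega>\<bar>) = expectation (\<lambda>\<omega>. 0::real)"
      using AE by (intro integral_cong_AE) auto
    ultimately show ?thesis using True by simp
  next
    case False
    then have v': "0 < v" using v by simp
    have norm: "distributed M lborel Z (normal_density 0 (sqrt v))"
      if "distr M borel Z = normal_law 0 v" "Z \<in> borel_measurable M" for Z
    proof -
      have "distr M lborel Z = distr M borel Z" by (intro distr_cong) auto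
      then show ?thesis
        using that False by (simp add: distributed_def normal_law_def)
    qed
    define s where "s = sqrt (2 * v)"
    have s: "0 < s" using v' by (simp add: s_def)
    have D: "distributed M lborel (\<lambda>\<omega>. X \<omega> - Y \<omega>) (normal_density 0 s)"
      using diff_indep_normal[OF indep _ _ norm[OF X] norm[OF Y]] v' by (simp add: s_def)
    have mom: "has_bochner_integral lborel (\<lambda>x. normal_density 0 s x * \<bar>x\<bar>) (s * sqrt (2 / pi))"
      using normal_moment_abs_odd[OF s, of 0 0] by simp
    have "integrable M (\<lambda>\<omega>. \<bar>X \<omega> - Y \<omega>\<bar>)"
      using distributed_integrable[OF D, of abs] mom by (auto simp: has_bochner_integral_iff)
    moreover have "expectation (\<lambda>\<omega>. \<bar>X \<omega> - Y \<omega>\<bar>) = s * sqrt (2 / pi)"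
      using distributed_integral[OF D, of abs] mom by (auto simp: has_bochner_integral_iff)
    moreover have "s * sqrt (2 / pi) = 2 * sqrt (v / pi)"
    proof -
      have "s * sqrt (2 / pi) = sqrt (2\<^sup>2 * (v / pi))"
        unfolding s_def by (simp flip: real_sqrt_mult)
      then show ?thesis by (simp only: real_sqrt_mult real_sqrt_abs abs_numeral)
    qed
    ultimately show ?thesis by simp
  qed
  then show "integrable M (\<lambda>\<omega>. \<bar>X \<omega> - Y \<omega>\<bar>)" "expectation (\<lambda>\<omega>. \<bar>X \<omega> - Y \<omega>\<bar>) = 2 * sqrt (v / pi)"
    by auto
qed

lemma noise_difference_on_block:
  assumes M: "prob_space M" and n: "2 \<le> n"
    and noise1: "zero_sum_gaussian_noise M n \<sigma> \<epsilon>1" and noise2: "zero_sum_gaussian_noise M n \<sigma> \<epsilon>2"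
    and indep: "prob_space.indep_var M (grid_vectors n) \<epsilon>1 (grid_vectors n) \<epsilon>2"
    and B: "B \<subseteq> grid n"
  shows "integrable M (\<lambda>\<omega>. \<bar>\<Sum>x\<in>B. \<epsilon>1 \<omega> x - \<epsilon>2 \<omega> x\<bar>)"
    and "prob_space.expectation M (\<lambda>\<omega>. \<bar>\<Sum>x\<in>B. \<epsilon>1 \<omega> x - \<epsilon>2 \<omega> x\<bar>)
      = 2 * sqrt (block_variance n \<sigma> (card B) / pi)"
proof -
  interpret prob_space M by (rule M)
  have lin: "(\<lambda>z. \<Sum>x\<in>B. z x) \<in> borel_measurable (grid_vectors n)"
    using B by (intro borel_measurable_sum measurable_component_singleton) auto
  have ind: "indep_var borel (\<lambda>\<omega>. \<Sum>x\<in>B. \<epsilon>1 \<omega> x) borel (\<lambda>\<omega>. \<Sum>x\<in>B. \<epsilon>2 \<omega> x)"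
    using indep_var_compose[OF indep lin lin] by (simp add: comp_def)
  have v: "0 \<le> block_variance n \<sigma> (card B)"
    using B card_mono[OF finite_grid B] by (intro block_variance_nonneg n) (simp add: card_grid)
  note abs_diff = abs_diff_normal_law[OF ind v distr_noise_sum[OF noise1 n B] distr_noise_sum[OF noise2 n B]]
  show "integrable M (\<lambda>\<omega>. \<bar>\<Sum>x\<in>B. \<epsilon>1 \<omega> x - \<epsilon>2 \<omega> x\<bar>)"
    "expectation (\<lambda>\<omega>. \<bar>\<Sum>x\<in>B. \<epsilon>1 \<omega> x - \<epsilon>2 \<omega> x\<bar>) = 2 * sqrt (block_variance n \<sigma> (card B) / pi)"
    using abs_diff by (simp_all add: sum_subtractf)
qed

section \<open>The expected discrepancy of two noisy copies\<close>

theorem theorem3p4: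
  fixes M :: "'a measure" and \<epsilon>1 \<epsilon>2 :: "'a \<Rightarrow> pixel \<Rightarrow> real"
    and n \<eta> :: nat and \<mu> :: "pixel \<Rightarrow> real" and \<sigma> :: real
  assumes "\<eta> \<ge> 1" and "n = 2 ^ \<eta>"
    and "prob_on_grid n \<mu>"
    and "\<sigma> > 0"
    and "prob_space M"
    and "zero_sum_gaussian_noise M n \<sigma> \<epsilon>1"
    and "zero_sum_gaussian_noise M n \<sigma> \<epsilon>2"
    and "prob_space.indep_var M (grid_vectors n) \<epsilon>1 (grid_vectors n) \<epsilon>2"
  defines "W \<equiv> \<lambda>\<omega>. signed_wasserstein n 1 (\<lambda>x. \<mu> x + \<epsilon>1 \<omega> x) (\<lambda>x. \<mu> x + \<epsilon>2 \<omega> x)"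
  shows "integrable M W
    \<and> real n * \<sigma> / sqrt pi \<le> prob_space.expectation M W
    \<and> prob_space.expectation M W
        \<le> (2 * sqrt 2 * log 2 (real n) + 1 / sqrt 2) / sqrt pi * real n * \<sigma>"
proof -
  interpret prob_space M by (rule assms(5))
  have "(2::nat) ^ 1 \<le> 2 ^ \<eta>" using assms(1) by (intro power_increasing) auto
  then have n2: "2 \<le> n" using assms(2) by simp
  then have n0: "0 < real n" by simp
  note \<sigma> = \<open>\<sigma> > 0\<close>
  let ?G = "grid n" and ?B = "\<lambda>k i. {x. x \<in> grid n \<and> block n k x = i}"
  define D where "D \<omega> x = \<epsilon>1 \<omega> x - \<epsilon>2 \<omega> x" for \<omega> x
  define L where "L \<omega> = 1 / (2 * real n) * (\<Sum>x\<in>?G. \<bar>D \<omega> x\<bar>)" for \<omega>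
  define U where "U \<omega> = (\<Sum>k<\<eta>. sqrt 2 * 2 ^ k / real n *
      (\<Sum>i\<in>block n k ` ?G. \<bar>\<Sum>x\<in>?B k i. D \<omega> x\<bar>))" for \<omega>
  have int: "integrable M (\<lambda>\<omega>. \<bar>\<Sum>x\<in>B. D \<omega> x\<bar>)"
    and exp: "expectation (\<lambda>\<omega>. \<bar>\<Sum>x\<in>B. D \<omega> x\<bar>) = 2 * sqrt (block_variance n \<sigma> (card B) / pi)"
    if "B \<subseteq> ?G" for B
    unfolding D_def
    by (rule noise_difference_on_block[OF assms(5) n2 assms(6-8) that])+
  have int1: "integrable M (\<lambda>\<omega>. \<bar>D \<omega> x\<bar>)"
    and exp1: "expectation (\<lambda>\<omega>. \<bar>D \<omega> x\<bar>) = 2 * sqrt (\<sigma>\<^sup>2 / pi)" if "x \<in> ?G" for x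
    using int[of "{x}"] exp[of "{x}"] that block_variance_1[OF n2] by simp_all
  have comp: "(\<lambda>\<omega>. \<epsilon>1 \<omega> x) \<in> borel_measurable M" "(\<lambda>\<omega>. \<epsilon>2 \<omega> x) \<in> borel_measurable M" if "x \<in> ?G" for x
    using assms(6,7) measurable_compose[OF _ measurable_component_singleton[OF that]]
    unfolding zero_sum_gaussian_noise_def by blast+
  have W_meas: "W \<in> borel_measurable M"
    unfolding W_def signed_wasserstein_1
    by (intro borel_measurable_transport_cost finite_grid torus_dist_nonneg add_nonneg_nonneg
        max.cobounded2 borel_measurable_add borel_measurable_max borel_measurable_uminus
        borel_measurable_const comp)
  (* The noise on the whole grid has variance 0, so couplings exist almost surely. *)
  have "AE \<omega> in M. (\<Sum>x\<in>?G. D \<omega> x) = 0"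
  proof -
    have "block_variance n \<sigma> (card ?G) = 0" by (simp add: block_variance_def card_grid)
    then have "expectation (\<lambda>\<omega>. \<bar>\<Sum>x\<in>?G. D \<omega> x\<bar>) = 0" using exp[of ?G] by simp
    then show ?thesis
      using integral_nonneg_eq_0_iff_AE[OF int[of ?G]] by simp
  qed
  then have bounds: "AE \<omega> in M. L \<omega> \<le> W \<omega> \<and> W \<omega> \<le> U \<omega>"
  proof (rule AE_mp, intro AE_I2 impI)
    fix \<omega> assume zero: "(\<Sum>x\<in>?G. D \<omega> x) = 0"
    define \<alpha> where "\<alpha> x = max (\<mu> x + \<epsilon>1 \<omega> x) 0 + max (- (\<mu> x + \<epsilon>2 \<omega> x)) 0" for x
    define \<beta> where "\<beta> x = max (\<mu> x + \<epsilon>2 \<omega> x) 0 + max (- (\<mu> x + \<epsilon>1 \<omega> x)) 0" for x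
    have D: "D \<omega> x = \<alpha> x - \<beta> x" for x
      by (auto simp: D_def \<alpha>_def \<beta>_def max_def)
    have "0 \<le> \<alpha> x" "0 \<le> \<beta> x" for x by (auto simp: \<alpha>_def \<beta>_def)
    from grid_transport_cost_bounds[of n \<eta> \<alpha> \<beta>, OF assms(2) this zero[unfolded D]]
    show "L \<omega> \<le> W \<omega> \<and> W \<omega> \<le> U \<omega>"
      unfolding L_def U_def W_def signed_wasserstein_1 D by (simp add: \<alpha>_def[abs_def] \<beta>_def[abs_def])
  qed
  have L_int: "integrable M L"
    unfolding L_def by (intro integrable_mult_right Bochner_Integration.integrable_sum int1)
  have U_int: "integrable M U"
    unfolding U_def by (intro integrable_mult_right Bochner_Integration.integrable_sum int) auto
  have L0: "0 \<le> L \<omega>" for \<omega> unfolding L_def by (intro mult_nonneg_nonneg sum_nonneg) auto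
  have W_int: "integrable M W"
  proof (rule Bochner_Integration.integrable_bound[OF U_int W_meas])
    show "AE \<omega> in M. norm (W \<omega>) \<le> norm (U \<omega>)"
      using bounds
    proof (rule AE_mp, intro AE_I2 impI)
      fix \<omega> assume "L \<omega> \<le> W \<omega> \<and> W \<omega> \<le> U \<omega>"
      then show "norm (W \<omega>) \<le> norm (U \<omega>)" using L0[of \<omega>] by simp
    qed
  qed
  have "expectation L = 1 / (2 * real n) * (\<Sum>x\<in>?G. 2 * sqrt (\<sigma>\<^sup>2 / pi))"
    unfolding L_def using int1 exp1 by simp
  also have "\<dots> = real n * \<sigma> / sqrt pi"
    using n0 \<sigma> by (simp add: card_grid real_sqrt_divide power2_eq_square)
  finally have lower: "real n * \<sigma> / sqrt pi \<le> expectation W"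
    using integral_mono_AE[OF L_int W_int] bounds by simp
  (* The factor 2^k from the block diameter and the factor 2^(\<eta> - k) from the Cauchy--Schwarz
     bound over the blocks multiply to n, so every level contributes the same amount. *)
  have level: "sqrt 2 * 2 ^ k / real n * (\<Sum>i\<in>block n k ` ?G. 2 * sqrt (block_variance n \<sigma> (card (?B k i)) / pi))
      \<le> 2 * sqrt 2 * real n * \<sigma> / sqrt pi" if k: "k < \<eta>" for k
  proof -
    have "2 * sqrt (block_variance n \<sigma> b / pi) \<le> 2 * \<sigma> / sqrt pi * sqrt b" for b :: nat
    proof -
      have "sqrt (block_variance n \<sigma> b / pi) \<le> sqrt (\<sigma>\<^sup>2 * b / pi)"
        by (intro real_sqrt_le_mono divide_right_mono block_variance_le n2) simp
      then show ?thesis using \<sigma> by (simp add: real_sqrt_mult real_sqrt_divide)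
    qed
    then have "(\<Sum>i\<in>block n k ` ?G. 2 * sqrt (block_variance n \<sigma> (card (?B k i)) / pi))
        \<le> 2 * \<sigma> / sqrt pi * (\<Sum>i\<in>block n k ` ?G. sqrt (card (?B k i)))"
      unfolding sum_distrib_left by (intro sum_mono) auto
    also have "\<dots> \<le> 2 * \<sigma> / sqrt pi * (2 ^ (\<eta> - k) * real n)"
      using \<sigma> k by (intro mult_left_mono sum_sqrt_card_blocks assms(2)) auto
    finally have "sqrt 2 * 2 ^ k / real n *
          (\<Sum>i\<in>block n k ` ?G. 2 * sqrt (block_variance n \<sigma> (card (?B k i)) / pi))
        \<le> sqrt 2 * 2 ^ k / real n * (2 * \<sigma> / sqrt pi * (2 ^ (\<eta> - k) * real n))"
      by (rule mult_left_mono) simp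
    also have "\<dots> = 2 * sqrt 2 * (2 ^ k * 2 ^ (\<eta> - k)) * \<sigma> / sqrt pi"
      using n0 by simp
    also have "(2::real) ^ k * 2 ^ (\<eta> - k) = real n"
      using k assms(2) by (simp flip: power_add)
    finally show ?thesis .
  qed
  have "expectation W \<le> expectation U"
    using bounds by (intro integral_mono_AE W_int U_int) auto
  also have "\<dots> = (\<Sum>k<\<eta>. sqrt 2 * 2 ^ k / real n *
      (\<Sum>i\<in>block n k ` ?G. 2 * sqrt (block_variance n \<sigma> (card (?B k i)) / pi)))"
  proof -
    have "integrable M (\<lambda>\<omega>. \<bar>\<Sum>x\<in>?B k i. D \<omega> x\<bar>)"
      "expectation (\<lambda>\<omega>. \<bar>\<Sum>x\<in>?B k i. D \<omega> x\<bar>) = 2 * sqrt (block_variance n \<sigma> (card (?B k i)) / pi)"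
      for k i by (rule int exp; blast)+
    then show ?thesis
      unfolding U_def by (simp add: Bochner_Integration.integral_sum)
  qed
  also have "\<dots> \<le> (\<Sum>k<\<eta>. 2 * sqrt 2 * real n * \<sigma> / sqrt pi)"
    by (intro sum_mono level) simp
  also have "\<dots> = 2 * sqrt 2 * log 2 (real n) / sqrt pi * real n * \<sigma>"
    using assms(2) by (simp add: log_nat_power)
  also have "\<dots> \<le> (2 * sqrt 2 * log 2 (real n) + 1 / sqrt 2) / sqrt pi * real n * \<sigma>"
    using \<sigma> by (intro mult_right_mono divide_right_mono) auto
  finally show ?thesis using W_int lower by blast
qed

end
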